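(* Let $n \in \mathbb{N}$ and $\delta \in (0,1)$ be parameters such that $\delta > O(1/n^{o(1)})$ (that is, $\delta^{-1} = n^{o(1)}$). Then there exists a greedy open-addressing scheme that supports $n - \lfloor \delta n \rfloor$ insertions into an array of size $n$, and that has worst-case expected probe complexity (and worst-case expected insertion time) $O(\log^2 \delta^{-1})$. Furthermore, with probability $1 - 1/\mathrm{poly}(n)$, the maximum probe complexity over all insertions is $O(\log^2 \delta^{-1} + \log\log n)$. Finally, the amortized expected probe complexity is $O(\log \delta^{-1})$.
   Context: An open-addressed hash table without reordering with capacity $n$ consists of an array of $n$ slots indexed by $[n]=\{1,\dots,n\}$, initially empty. Keys $x_1,x_2,\dots$ are inserted one after another. Each key $x$ comes with an infinite probe sequence $h_1(x),h_2(x),\dots \in [n]^{\infty}$, and the probe sequences of the keys are drawn independently from a common distribution $\mathcal{P}$. To insert $x$, an insertion algorithm $\mathcal{A}$ must place $x$ into some currently unoccupied slot $h_j(x)$; elements are never moved after being placed. If $x$ is placed in slot $h_j(x)$, then $x$ has probe complexity $j$. The scheme is greedy if every key is placed into the first unoccupied slot in its probe sequence. The insertion time of an insertion is the number of slots it examines. The amortized expected probe complexity is the expected value of the average probe complexity over all inserted keys; the worst-case expected probe complexity is the maximum, over all insertions, of the expected probe complexity of the inserted key. $\log$ denotes the base-2 logarithm.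
   Formalization: The bounds O(log² δ⁻¹) and O(log δ⁻¹) on expected probe complexity and insertion time are read as O(1 + log² δ⁻¹) and O(1 + log δ⁻¹), since the literal bounds fail as δ → 1 (e.g. δ = 1 − 1/n); for δ bounded away from 1 they agree. *)

theory Defs
  imports "HOL-Probability.Probability"
begin

text \<open>
  Slots are \<open>1, \<dots>, n\<close>.  Keys and probes are indexed from \<open>0\<close>: \<open>h k\<close> is the
  \<open>(k+1)\<close>-st entry of the probe sequence \<open>h\<close>, and \<open>H i\<close> is the probe sequence of the
  \<open>(i+1)\<close>-st inserted key.  Greediness determines the insertion algorithm, so a greedy
  scheme is given by its distribution \<open>P\<close> on probe sequences.
\<close>

type_synonym probe_seq = "nat \<Rightarrow> nat"

definition probe_distribution :: "nat \<Rightarrow> probe_seq measure \<Rightarrow> bool" where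
  "probe_distribution n P \<longleftrightarrow>
     prob_space P \<and> sets P = sets (\<Pi>\<^sub>M k\<in>(UNIV :: nat set). count_space {1..n})"

text \<open>Joint distribution of the independent probe sequences of \<open>m\<close> keys.\<close>

definition keys :: "probe_seq measure \<Rightarrow> nat \<Rightarrow> (nat \<Rightarrow> probe_seq) measure" where
  "keys P m = (\<Pi>\<^sub>M i\<in>{..<m}. P)"

definition has_free_slot :: "nat set \<Rightarrow> probe_seq \<Rightarrow> bool" where
  "has_free_slot occ h \<longleftrightarrow> (\<exists>k. h k \<notin> occ)"

definition first_free :: "nat set \<Rightarrow> probe_seq \<Rightarrow> nat" where
  "first_free occ h = (LEAST k. h k \<notin> occ)"

text \<open>
  The set of occupied slots after the first \<open>i\<close> greedy insertions; a key whose probe sequence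
  meets no free slot is not placed.
\<close>

primrec occupied :: "(nat \<Rightarrow> probe_seq) \<Rightarrow> nat \<Rightarrow> nat set" where
  "occupied H 0 = {}"
| "occupied H (Suc i) =
     (if has_free_slot (occupied H i) (H i)
      then insert (H i (first_free (occupied H i) (H i))) (occupied H i)
      else occupied H i)"

definition supports_insertions :: "probe_seq measure \<Rightarrow> nat \<Rightarrow> bool" where
  "supports_insertions P m \<longleftrightarrow>
     (AE H in keys P m. \<forall>i<m. has_free_slot (occupied H i) (H i))"

definition probe_complexity :: "(nat \<Rightarrow> probe_seq) \<Rightarrow> nat \<Rightarrow> ennreal" where
  "probe_complexity H i =
     (if has_free_slot (occupied H i) (H i)
      then of_nat (Suc (first_free (occupied H i) (H i))) else \<infinity>)"

text \<open>
  The greedy algorithm scans the probe sequence in order, so it examines the entry at position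
  \<open>k\<close> iff all earlier entries were found occupied.  Repeated visits to a slot are counted.
\<close>

definition insertion_time :: "(nat \<Rightarrow> probe_seq) \<Rightarrow> nat \<Rightarrow> ennreal" where
  "insertion_time H i = emeasure (count_space UNIV) {k. \<forall>j<k. H i j \<in> occupied H i}"

definition worst_expected_probe_complexity :: "probe_seq measure \<Rightarrow> nat \<Rightarrow> ennreal" where
  "worst_expected_probe_complexity P m =
     (SUP i\<in>{..<m}. \<integral>\<^sup>+ H. probe_complexity H i \<partial>keys P m)"

definition worst_expected_insertion_time :: "probe_seq measure \<Rightarrow> nat \<Rightarrow> ennreal" where
  "worst_expected_insertion_time P m =
     (SUP i\<in>{..<m}. \<integral>\<^sup>+ H. insertion_time H i \<partial>keys P m)"

definition amortized_expected_probe_complexity :: "probe_seq measure \<Rightarrow> nat \<Rightarrow> ennreal" where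
  "amortized_expected_probe_complexity P m =
     (\<integral>\<^sup>+ H. (\<Sum>i<m. probe_complexity H i) / of_nat m \<partial>keys P m)"

definition max_probe_complexity :: "(nat \<Rightarrow> probe_seq) \<Rightarrow> nat \<Rightarrow> ennreal" where
  "max_probe_complexity H m = (SUP i\<in>{..<m}. probe_complexity H i)"

definition num_insertions :: "nat \<Rightarrow> real \<Rightarrow> nat" where
  "num_insertions n d = n - nat \<lfloor>d * real n\<rfloor>"

text \<open>\<open>f(n) = n\<^bsup>o(1)\<^esup>\<close>\<close>

definition subpolynomial :: "(nat \<Rightarrow> real) \<Rightarrow> bool" where
  "subpolynomial f \<longleftrightarrow>
     (\<exists>e :: nat \<Rightarrow> real. e \<longlonglongrightarrow> 0 \<and> (\<forall>\<^sub>F n in sequentially. f n = real n powr e n))"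

end

theory Submission
  imports Defs "HOL-Real_Asymp.Real_Asymp"
begin

text \<open>
  The scheme is a variant of funnel hashing.  The array is cut into levels of buckets; a key picks
  one uniform bucket per level and scans the chosen buckets level by level, and then sweeps the
  whole array, so that it always finds a slot.  With \<open>l = log \<delta>\<^bsup>-1\<^esup> + O(1)\<close>, the first \<open>512 l\<close> levels have
  buckets of width \<open>l + 3\<close> and each takes a \<open>1/512\<close> fraction of the remaining slots.  A level with
  \<open>N\<close> slots that receives \<open>4 N\<close> attempts is filled except for a fraction \<open>2\<^bsup>-l\<^esup>\<close>, while a level that
  receives fewer attempts passes on few keys relative to the slots behind it; in both cases only
  few keys leave the last of these levels.  The remaining \<open>2 log log n\<close> levels have buckets of
  width 1 and sizes \<open>R/2, R/4, \<dots>\<close>.  If a level is hit by a fraction \<open>p\<close> of its size, then about a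
  fraction \<open>p\<^sup>2\<close> goes on, so the load drops doubly exponentially and no key survives all levels.

  All concentration bounds come from one supermartingale: the product over the keys of weights
  whose conditional mean given the earlier keys is at most 1.  Every failure probability is
  superpolynomially small, so that one scheme serves all exponents \<open>c\<close>.
\<close>

section \<open>Products of finitely many independent choices\<close>

text \<open>The free slots pay for two losses. The factor \<open>(511 / 512) ^ 512\<close> lies
  between 1/4 and 1/2, so \<open>512 * l\<close> levels leave at most \<open>2 * n / 2 ^ l\<close>
  slots behind the funnel, and the holes inside it number at most \<open>n / 2 ^ l\<close>. With
  \<open>3 * n / 2 ^ l\<close> free slots to spare, keys of a typical run can leave the funnel only
  if some level received fewer than four times its size in attempts. The number 512 makes a level so
  thin that even this fourfold load is below 1/64 of the slots behind it, and that proportion then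
  persists to the end of the funnel. Of the overflow levels, the first half brings the load down to
  \<open>1 / sqrt n\<close>; no further decay is claimed, since counts below \<theta>, later
  \<open>n powr (1 / 4)\<close>, are not controlled. The second half gains a factor
  \<open>1 / sqrt n\<close> per level, so \<open>log log n\<close> levels beat every power of
  \<open>n\<close>. The amortized bound saves a logarithm because a level is reached by at most as
  many keys as there are slots from it on; these slot counts decay geometrically, so an average key
  visits O(1) levels.\<close>

lemma nn_integral_Pi_pmf_component:
  assumes "finite I" "i \<in> I"
  shows "(\<integral>\<^sup>+\<sigma>. f \<sigma> \<partial>Pi_pmf I d p) =
    (\<integral>\<^sup>+\<sigma>. \<integral>\<^sup>+s. f (\<sigma>(i := s)) \<partial>measure_pmf (p i) \<partial>Pi_pmf (I - {i}) d p)"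
proof -
  have "Pi_pmf I d p = Pi_pmf (insert i (I - {i})) d p"
    using assms by (simp add: insert_absorb)
  also have "\<dots> = map_pmf (\<lambda>(f, y). f(i := y)) (pair_pmf (Pi_pmf (I - {i}) d p) (p i))"
    using assms by (subst Pi_pmf_insert) (auto simp: pair_commute_pmf[of "p i"] map_pmf_comp case_prod_unfold)
  finally show ?thesis
    by (simp add: nn_integral_pair_pmf' case_prod_unfold)
qed

text \<open>Fubini with coordinate \<open>i\<close> innermost: a bound on resampling one coordinate,
  uniform in the others, bounds the whole integral.\<close>

lemma nn_integral_Pi_pmf_le:
  assumes "finite I" "i \<in> I"
    and le: "\<And>\<sigma>. (\<And>k. k \<in> I \<Longrightarrow> \<sigma> k \<in> set_pmf (p k)) \<Longrightarrow> (\<integral>\<^sup>+s. f (\<sigma>(i := s)) \<partial>measure_pmf (p i)) \<le> c"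
  shows "(\<integral>\<^sup>+\<sigma>. f \<sigma> \<partial>Pi_pmf I d p) \<le> c"
proof -
  obtain s0 where s0: "s0 \<in> set_pmf (p i)"
    using set_pmf_not_empty by fast
  have "(\<integral>\<^sup>+\<sigma>. f \<sigma> \<partial>Pi_pmf I d p) \<le> (\<integral>\<^sup>+\<sigma>. c \<partial>Pi_pmf (I - {i}) d p)"
    unfolding nn_integral_Pi_pmf_component[OF assms(1,2)]
  proof (rule nn_integral_mono_AE, subst AE_measure_pmf_iff, intro ballI)
    fix \<sigma> assume "\<sigma> \<in> set_pmf (Pi_pmf (I - {i}) d p)"
    then have "\<sigma> k \<in> set_pmf (p k)" if "k \<in> I - {i}" for k
      using that assms(1) by (auto simp: set_Pi_pmf PiE_dflt_def)
    \<comment> \<open>In the smaller product, coordinate \<open>i\<close> carries the default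
      \<open>d\<close>, which may lie outside the support; \<open>s0\<close> replaces it and is then
      overwritten by \<open>s\<close>.\<close>
    then have "(\<integral>\<^sup>+s. f ((\<sigma>(i := s0))(i := s)) \<partial>measure_pmf (p i)) \<le> c"
      using s0 by (intro le) auto
    then show "(\<integral>\<^sup>+s. f (\<sigma>(i := s)) \<partial>measure_pmf (p i)) \<le> c"
      by simp
  qed
  also have "\<dots> = c"
    by (simp add: measure_pmf.emeasure_space_1)
  finally show ?thesis .
qed

text \<open>The supermartingale inequality in discrete form. \<open>F i\<close> is the weight of key
  \<open>i\<close> given its history; by \<open>dep\<close> no weight sees later keys, so the last
  key can be integrated out first.\<close>

lemma nn_integral_prod_le_1:
  fixes F :: "nat \<Rightarrow> (nat \<Rightarrow> 's) \<Rightarrow> 's \<Rightarrow> ennreal"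
  assumes dep: "\<And>i \<sigma> \<sigma>' s. (\<And>k. k < i \<Longrightarrow> \<sigma> k = \<sigma>' k) \<Longrightarrow> F i \<sigma> s = F i \<sigma>' s"
    and le: "\<And>i \<sigma>. i < m \<Longrightarrow> (\<And>k. k < i \<Longrightarrow> \<sigma> k \<in> set_pmf p) \<Longrightarrow>
               (\<integral>\<^sup>+s. F i \<sigma> s \<partial>measure_pmf p) \<le> 1"
  shows "(\<integral>\<^sup>+\<sigma>. (\<Prod>i<m. F i \<sigma> (\<sigma> i)) \<partial>Pi_pmf {..<m} d (\<lambda>_. p)) \<le> 1"
  using le
proof (induction m)
  case 0
  then show ?case by simp
next
  case (Suc m)
  have "(\<integral>\<^sup>+\<sigma>. (\<Prod>i<Suc m. F i \<sigma> (\<sigma> i)) \<partial>Pi_pmf {..<Suc m} d (\<lambda>_. p)) =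
    (\<integral>\<^sup>+\<sigma>. \<integral>\<^sup>+s. (\<Prod>i<Suc m. F i (\<sigma>(m := s)) ((\<sigma>(m := s)) i)) \<partial>measure_pmf p \<partial>Pi_pmf {..<m} d (\<lambda>_. p))"
    by (subst nn_integral_Pi_pmf_component[where i = m]) (auto simp: lessThan_Suc)
  also have "\<dots> = (\<integral>\<^sup>+\<sigma>. \<integral>\<^sup>+s. (\<Prod>i<m. F i \<sigma> (\<sigma> i)) * F m \<sigma> s \<partial>measure_pmf p \<partial>Pi_pmf {..<m} d (\<lambda>_. p))"
  proof (intro nn_integral_cong)
    fix \<sigma> :: "nat \<Rightarrow> 's" and s
    have "F i (\<sigma>(m := s)) u = F i \<sigma> u" if "i \<le> m" for i u
      using that by (intro dep) auto
    then show "(\<Prod>i<Suc m. F i (\<sigma>(m := s)) ((\<sigma>(m := s)) i)) = (\<Prod>i<m. F i \<sigma> (\<sigma> i)) * F m \<sigma> s"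
      by simp
  qed
  also have "\<dots> = (\<integral>\<^sup>+\<sigma>. (\<Prod>i<m. F i \<sigma> (\<sigma> i)) * (\<integral>\<^sup>+s. F m \<sigma> s \<partial>measure_pmf p) \<partial>Pi_pmf {..<m} d (\<lambda>_. p))"
    by (simp add: nn_integral_cmult)
  also have "\<dots> \<le> (\<integral>\<^sup>+\<sigma>. (\<Prod>i<m. F i \<sigma> (\<sigma> i)) * 1 \<partial>Pi_pmf {..<m} d (\<lambda>_. p))"
  proof (rule nn_integral_mono_AE, subst AE_measure_pmf_iff, intro ballI mult_left_mono)
    fix \<sigma> assume "\<sigma> \<in> set_pmf (Pi_pmf {..<m} d (\<lambda>_. p))"
    then have "\<sigma> k \<in> set_pmf p" if "k < m" for k
      using that by (auto simp: set_Pi_pmf PiE_dflt_def)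
    then show "(\<integral>\<^sup>+s. F m \<sigma> s \<partial>measure_pmf p) \<le> 1"
      by (intro Suc.prems) auto
  qed auto
  also have "\<dots> \<le> 1"
    using Suc by simp
  finally show ?case .
qed

text \<open>Moves all probability to discrete seeds, where every set is measurable. The two product
  measures agree on rectangles, which suffices for a finite index set.\<close>

lemma PiM_distr_pmf:
  fixes p :: "'s pmf"
  assumes f: "f \<in> measure_pmf p \<rightarrow>\<^sub>M M" and I: "finite I"
  shows "PiM I (\<lambda>_. distr (measure_pmf p) M f) =
    distr (measure_pmf (Pi_pmf I d (\<lambda>_. p))) (PiM I (\<lambda>_. M)) (\<lambda>\<sigma>. \<lambda>i\<in>I. f (\<sigma> i))"
proof -
  interpret P: prob_space "distr (measure_pmf p) M f"
    by (rule measure_pmf.prob_space_distr[OF f])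
  interpret Q: product_prob_space "\<lambda>_. distr (measure_pmf p) M f" I
    by unfold_locales
  let ?g = "\<lambda>\<sigma>. \<lambda>i\<in>I. f (\<sigma> i)"
  have sp: "f s \<in> space M" for s
    using measurable_space[OF f, of s] by simp
  have g: "?g \<in> measure_pmf (Pi_pmf I d (\<lambda>_. p)) \<rightarrow>\<^sub>M PiM I (\<lambda>_. M)"
    by (auto simp: space_PiM sp)
  show ?thesis
  proof (rule Q.PiM_eqI[symmetric, OF I])
    show "sets (distr (measure_pmf (Pi_pmf I d (\<lambda>_. p))) (PiM I (\<lambda>_. M)) ?g)
       = sets (PiM I (\<lambda>_. distr (measure_pmf p) M f))"
      by (simp cong: sets_PiM_cong)
    fix A assume A: "\<And>i. i \<in> I \<Longrightarrow> A i \<in> sets (distr (measure_pmf p) M f)"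
    have "emeasure (distr (measure_pmf (Pi_pmf I d (\<lambda>_. p))) (PiM I (\<lambda>_. M)) ?g) (Pi\<^sub>E I A)
      = emeasure (measure_pmf (Pi_pmf I d (\<lambda>_. p))) (?g -` Pi\<^sub>E I A)"
      using A by (subst emeasure_distr[OF g]) (auto intro!: sets_PiM_I_finite I)
    also have "?g -` Pi\<^sub>E I A = Pi I (\<lambda>i. f -` A i)"
      by auto
    also have "emeasure (measure_pmf (Pi_pmf I d (\<lambda>_. p))) \<dots> = (\<Prod>i\<in>I. emeasure (measure_pmf p) (f -` A i))"
      by (simp add: measure_pmf.emeasure_eq_measure measure_Pi_pmf_Pi I prod_ennreal)
    also have "\<dots> = (\<Prod>i\<in>I. emeasure (distr (measure_pmf p) M f) (A i))"
      using A by (intro prod.cong refl) (simp add: emeasure_distr[OF f])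
    finally show "emeasure (distr (measure_pmf (Pi_pmf I d (\<lambda>_. p))) (PiM I (\<lambda>_. M)) ?g) (Pi\<^sub>E I A)
      = (\<Prod>i\<in>I. emeasure (distr (measure_pmf p) M f) (A i))" .
  qed
qed

section \<open>Level schemes\<close>

locale bucket_levels =
  fixes n L :: nat and b w :: "nat \<Rightarrow> nat"
  assumes n_pos: "1 \<le> n"
    and b_pos: "j < L \<Longrightarrow> 0 < b j"
    and fits: "(\<Sum>j<L. b j * w j) \<le> n"
begin

text \<open>
  A seed \<open>s\<close> is the choice of one bucket per level, and \<open>A j x\<close> counts the keys that tried bucket
  \<open>x\<close> of level \<open>j\<close> so far; the bucket is full iff this count is at least \<open>w j\<close>.  Keys that find all
  levels full count as dropped here; the real table agrees until this happens for the first time.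
\<close>

definition reaches :: "(nat \<Rightarrow> nat \<Rightarrow> nat) \<Rightarrow> (nat \<Rightarrow> nat) \<Rightarrow> nat \<Rightarrow> bool" where
  "reaches A s j \<longleftrightarrow> (\<forall>i<j. w i \<le> A i (s i))"

primrec attempts :: "(nat \<Rightarrow> nat \<Rightarrow> nat) \<Rightarrow> nat \<Rightarrow> nat \<Rightarrow> nat \<Rightarrow> nat" where
  "attempts \<sigma> 0 = (\<lambda>_ _. 0)"
| "attempts \<sigma> (Suc i) = (\<lambda>j x. attempts \<sigma> i j x
     + of_bool (reaches (attempts \<sigma> i) (\<sigma> i) j \<and> \<sigma> i j = x))"

abbreviation arrives :: "(nat \<Rightarrow> nat \<Rightarrow> nat) \<Rightarrow> nat \<Rightarrow> nat \<Rightarrow> bool" where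
  "arrives \<sigma> i j \<equiv> reaches (attempts \<sigma> i) (\<sigma> i) j"

definition arrivals :: "(nat \<Rightarrow> nat \<Rightarrow> nat) \<Rightarrow> nat \<Rightarrow> nat \<Rightarrow> nat" where
  "arrivals \<sigma> i j = (\<Sum>k<i. of_bool (arrives \<sigma> k j))"

definition valid :: "(nat \<Rightarrow> nat) \<Rightarrow> bool" where
  "valid s \<longleftrightarrow> (\<forall>j<L. s j < b j)"

definition slot :: "nat \<Rightarrow> nat \<Rightarrow> nat \<Rightarrow> nat" where
  "slot j x y = 1 + (\<Sum>i<j. b i * w i) + x * w j + y"

definition probes :: "(nat \<Rightarrow> nat) \<Rightarrow> nat list" where
  "probes s = concat (map (\<lambda>j. map (slot j (s j)) [0..<w j]) [0..<L]) @ [1..<Suc n]"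

text \<open>Padded with slot 1 past the end of the list and wherever an entry would leave the array:
  every seed, even an invalid one, then gives a legal infinite sequence, and measurability needs no
  condition on the seed.\<close>

definition sequence :: "(nat \<Rightarrow> nat) \<Rightarrow> probe_seq" where
  "sequence s k = (if k < length (probes s) \<and> probes s ! k \<in> {1..n} then probes s ! k else 1)"

text \<open>A bucket is filled in order, so the number of attempts determines which of its slots are occupied.\<close>

definition filled :: "(nat \<Rightarrow> nat \<Rightarrow> nat) \<Rightarrow> nat set" where
  "filled A = {slot j x y | j x y. j < L \<and> x < b j \<and> y < w j \<and> y < A j x}"

lemma reaches_0 [simp]: "reaches A s 0"
  by (simp add: reaches_def)

lemma reaches_Suc: "reaches A s (Suc j) \<longleftrightarrow> reaches A s j \<and> w j \<le> A j (s j)"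
  by (auto simp: reaches_def less_Suc_eq)

lemma reaches_mono: "reaches A s j \<Longrightarrow> i \<le> j \<Longrightarrow> reaches A s i"
  by (auto simp: reaches_def)

lemma not_reaches_stops:
  assumes "\<not> reaches A s j"
  obtains i where "i < j" "reaches A s i" "A i (s i) < w i"
proof -
  have "\<exists>i<j. reaches A s i \<and> A i (s i) < w i"
    using assms
  proof (induction j)
    case (Suc j)
    then show ?case
      by (cases "reaches A s j") (auto simp: reaches_Suc not_le less_Suc_eq)
  qed simp
  then show ?thesis using that by blast
qed

section \<open>Layout of the buckets in the array\<close>

lemma slot_less:
  assumes "x < b j" "y < w j"
  shows "slot j x y \<le> (\<Sum>i<Suc j. b i * w i)"
proof -
  have "x * w j + y < Suc x * w j"
    using assms by simp
  also have "\<dots> \<le> b j * w j"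
    using assms by (intro mult_right_mono) auto
  finally show ?thesis by (simp add: slot_def)
qed

lemma slot_range:
  assumes "j < L" "x < b j" "y < w j"
  shows "slot j x y \<in> {1..n}"
proof -
  have "slot j x y \<le> (\<Sum>i<Suc j. b i * w i)"
    using assms by (intro slot_less)
  also have "\<dots> \<le> (\<Sum>i<L. b i * w i)"
    using assms by (intro sum_mono2) auto
  finally show ?thesis using fits by (simp add: slot_def)
qed

lemma slot_level_less:
  assumes "x < b j" "y < w j" "j < j'"
  shows "slot j x y < slot j' x' y'"
proof -
  have "slot j x y \<le> (\<Sum>i<Suc j. b i * w i)"
    using assms by (intro slot_less)
  also have "\<dots> \<le> (\<Sum>i<j'. b i * w i)"
    using assms by (intro sum_mono2) auto
  finally show ?thesis by (simp add: slot_def)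
qed

lemma slot_inj:
  assumes "slot j x y = slot j' x' y'" "x < b j" "y < w j" "x' < b j'" "y' < w j'"
  shows "j = j' \<and> x = x' \<and> y = y'"
proof -
  have j: "j = j'"
    using slot_level_less[of x j y j' x' y'] slot_level_less[of x' j' y' j x y] assms
    by (metis less_irrefl linorder_neqE_nat)
  then have eq: "x * w j + y = x' * w j + y'"
    using assms by (simp add: slot_def)
  have "x = (x * w j + y) div w j" "x' = (x' * w j + y') div w j"
    using assms j by auto
  with eq j show ?thesis by auto
qed

lemma slot_filled_iff:
  assumes "j < L" "x < b j" "y < w j"
  shows "slot j x y \<in> filled A \<longleftrightarrow> y < A j x"
  using assms slot_inj[OF _ assms(2,3)] by (fastforce simp: filled_def)

lemma length_probes: "length (probes s) = (\<Sum>j<L. w j) + n"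
  by (simp add: probes_def length_concat comp_def interv_sum_list_conv_sum_set_nat atLeast0LessThan)

lemma sequence_range: "sequence s k \<in> {1..n}"
  using n_pos by (auto simp: sequence_def)

lemma sequence_probes:
  assumes "valid s" "k < length (probes s)"
  shows "sequence s k = probes s ! k"
proof -
  have "set (probes s) \<subseteq> {1..n}"
    using assms(1) slot_range by (auto simp: probes_def valid_def simp del: atLeastAtMost_iff) auto
  then show ?thesis
    using nth_mem[OF assms(2)] assms(2) unfolding sequence_def by (metis subsetD)
qed

section \<open>Agreement of the greedy table with the bucket counters\<close>

lemma first_free_split:
  assumes "valid s" "probes s = ys @ z # zs" "set ys \<subseteq> occ" "z \<notin> occ"
  shows "has_free_slot occ (sequence s)" "first_free occ (sequence s) = length ys"
    "sequence s (length ys) = z"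
proof -
  have eq: "sequence s k = (ys @ z # zs) ! k" if "k \<le> length ys" for k
    using sequence_probes[OF assms(1), of k] that assms(2) by simp
  show z: "sequence s (length ys) = z"
    using eq[of "length ys"] by simp
  then show "has_free_slot occ (sequence s)"
    using assms(4) by (auto simp: has_free_slot_def)
  show "first_free occ (sequence s) = length ys"
    unfolding first_free_def
  proof (rule Least_equality)
    show "sequence s (length ys) \<notin> occ" using z assms(4) by simp
    fix k assume k: "sequence s k \<notin> occ"
    show "length ys \<le> k"
    proof (rule ccontr)
      assume "\<not> length ys \<le> k"
      then have "sequence s k = ys ! k" "k < length ys"
        using eq[of k] by (auto simp: nth_append)
      then show False using k assms(3) nth_mem by fastforce
    qed
  qed
qed

text \<open>The scan crosses the full buckets of the levels before \<open>j\<close> entirely, which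
  costs their widths; the bucket at level \<open>j\<close> is filled from the left, so its first
  free position is its own counter.\<close>

lemma first_free_stops:
  assumes "valid s" "j < L" "reaches A s j" "A j (s j) < w j"
  shows "has_free_slot (filled A) (sequence s)"
    "first_free (filled A) (sequence s) = (\<Sum>i<j. w i) + A j (s j)"
    "sequence s (first_free (filled A) (sequence s)) = slot j (s j) (A j (s j))"
proof -
  let ?f = "\<lambda>j. map (slot j (s j)) [0..<w j]"
  let ?a = "A j (s j)"
  have L: "[0..<L] = [0..<j] @ j # [Suc j..<L]"
    using assms(2) by (metis less_imp_le upt_conv_Cons le_add_diff_inverse upt_add_eq_append zero_le)
  have W: "[0..<w j] = [0..<?a] @ ?a # [Suc ?a..<w j]"
    using assms(4) by (metis less_imp_le upt_conv_Cons le_add_diff_inverse upt_add_eq_append zero_le)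
  define ys where "ys = concat (map ?f [0..<j]) @ map (slot j (s j)) [0..<?a]"
  have split: "\<exists>zs. probes s = ys @ slot j (s j) ?a # zs"
    unfolding probes_def ys_def L by (simp add: W)
  then obtain zs where zs: "probes s = ys @ slot j (s j) ?a # zs" ..
  have ys: "set ys \<subseteq> filled A"
  proof -
    have "slot i (s i) y \<in> filled A" if "i < j" "y < w i" for i y
      using that assms by (subst slot_filled_iff) (auto simp: valid_def reaches_def intro: less_le_trans)
    moreover have "slot j (s j) y \<in> filled A" if "y < ?a" for y
      using that assms by (subst slot_filled_iff) (auto simp: valid_def)
    ultimately show ?thesis by (auto simp: ys_def)
  qed
  have z: "slot j (s j) ?a \<notin> filled A"
    using assms by (subst slot_filled_iff) (auto simp: valid_def)
  have len: "length ys = (\<Sum>i<j. w i) + ?a"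
    by (simp add: ys_def length_concat comp_def interv_sum_list_conv_sum_set_nat atLeast0LessThan)
  note * = first_free_split[OF assms(1) zs ys z]
  show "has_free_slot (filled A) (sequence s)"
    "first_free (filled A) (sequence s) = (\<Sum>i<j. w i) + A j (s j)"
    "sequence s (first_free (filled A) (sequence s)) = slot j (s j) (A j (s j))"
    using * len by simp_all
qed

text \<open>A key raises a counter on every level it tries, but on levels before \<open>j\<close>
  the bucket was already full and levels after \<open>j\<close> are not reached. Only the stopping
  level gains a slot.\<close>

lemma filled_attempts_Suc:
  assumes "valid (\<sigma> i)" "j < L" "arrives \<sigma> i j" "attempts \<sigma> i j (\<sigma> i j) < w j"
  shows "filled (attempts \<sigma> (Suc i)) =
    insert (slot j (\<sigma> i j) (attempts \<sigma> i j (\<sigma> i j))) (filled (attempts \<sigma> i))"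
proof -
  let ?A = "attempts \<sigma> i" and ?A' = "attempts \<sigma> (Suc i)"
  have eq: "y < w j' \<and> y < ?A' j' x \<longleftrightarrow> y < w j' \<and> y < ?A j' x \<or> j' = j \<and> x = \<sigma> i j \<and> y = ?A j (\<sigma> i j)"
    if "j' < L" "x < b j'" for j' x y
  proof (cases "arrives \<sigma> i j' \<and> \<sigma> i j' = x")
    case False
    then show ?thesis using assms(3) by auto
  next
    case True
    then consider "j' = j" | "j' < j" | "j < j'"
      by linarith
    then show ?thesis
    proof cases
      case 1 then show ?thesis using True assms(4) by auto
    next
      case 2 then show ?thesis using True assms(3) by (auto simp: reaches_def)
    next
      case 3
      then have "w j \<le> ?A j (\<sigma> i j)"
        using True by (auto simp: reaches_def)
      then show ?thesis using assms(4) by simp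
    qed
  qed
  have "\<sigma> i j < b j"
    using assms by (simp add: valid_def)
  show ?thesis (is "?l = ?r")
  proof (rule set_eqI)
    fix u
    have "u \<in> ?l \<longleftrightarrow> (\<exists>j' x y. u = slot j' x y \<and> j' < L \<and> x < b j' \<and> (y < w j' \<and> y < ?A' j' x))"
      by (auto simp: filled_def)
    also have "\<dots> \<longleftrightarrow> (\<exists>j' x y. u = slot j' x y \<and> j' < L \<and> x < b j' \<and>
       (y < w j' \<and> y < ?A j' x \<or> j' = j \<and> x = \<sigma> i j \<and> y = ?A j (\<sigma> i j)))"
      using eq by blast
    also have "\<dots> \<longleftrightarrow> u \<in> ?r"
      using \<open>\<sigma> i j < b j\<close> assms(2) by (auto simp: filled_def)
    finally show "u \<in> ?l \<longleftrightarrow> u \<in> ?r" .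
  qed
qed

lemma occupied_eq_filled:
  assumes "\<And>k. k < i \<Longrightarrow> valid (\<sigma> k)" "\<And>k. k < i \<Longrightarrow> \<not> arrives \<sigma> k L"
  shows "occupied (\<lambda>k. sequence (\<sigma> k)) i = filled (attempts \<sigma> i)"
  using assms
proof (induction i)
  case 0
  then show ?case by (simp add: filled_def)
next
  case (Suc i)
  then obtain j where j: "j < L" "arrives \<sigma> i j" "attempts \<sigma> i j (\<sigma> i j) < w j"
    using not_reaches_stops[of "attempts \<sigma> i" "\<sigma> i" L] by blast
  have v: "valid (\<sigma> i)" using Suc by simp
  have IH: "occupied (\<lambda>k. sequence (\<sigma> k)) i = filled (attempts \<sigma> i)"
    using Suc by simp
  show ?case
    using first_free_stops[OF v j] filled_attempts_Suc[OF v j] IH by simp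
qed

text \<open>Charging the full width of every level reached makes the cost linear in arrival
  indicators: summed over keys it becomes arrival counts, in expectation arrival probabilities.
  \<open>H\<close> is only required to agree with the seeds up to key \<open>i\<close>, because
  sampled key families are undefined beyond the last key.\<close>

lemma probe_complexity_le_arrives:
  assumes "\<And>k. k \<le> i \<Longrightarrow> valid (\<sigma> k)" "\<And>k. k \<le> i \<Longrightarrow> \<not> arrives \<sigma> k L"
    and H: "\<And>k. k \<le> i \<Longrightarrow> H k = sequence (\<sigma> k)"
  shows "probe_complexity H i \<le> of_nat (\<Sum>j<L. w j * of_bool (arrives \<sigma> i j))"
proof -
  obtain j where j: "j < L" "arrives \<sigma> i j" "attempts \<sigma> i j (\<sigma> i j) < w j"
    using assms not_reaches_stops[of "attempts \<sigma> i" "\<sigma> i" L] by blast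
  have occ: "occupied (\<lambda>k. sequence (\<sigma> k)) i = filled (attempts \<sigma> i)"
    using assms by (intro occupied_eq_filled) auto
  have occ': "occupied H i = occupied (\<lambda>k. sequence (\<sigma> k)) i"
  proof -
    have "occupied H k = occupied (\<lambda>k. sequence (\<sigma> k)) k" if "k \<le> i" for k
      using that by (induction k) (auto simp: H)
    then show ?thesis by simp
  qed
  have v: "valid (\<sigma> i)" using assms by simp
  have "Suc (first_free (filled (attempts \<sigma> i)) (sequence (\<sigma> i))) \<le> (\<Sum>k<Suc j. w k)"
    using first_free_stops[OF v j] j by simp
  also have "\<dots> = (\<Sum>k<Suc j. w k * of_bool (arrives \<sigma> i k))"
    using j(2) reaches_mono[OF j(2)] by (intro sum.cong) auto
  also have "\<dots> \<le> (\<Sum>k<L. w k * of_bool (arrives \<sigma> i k))"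
    using j by (intro sum_mono2) auto
  finally show ?thesis
    using first_free_stops(1)[OF v j] occ occ'
    unfolding probe_complexity_def of_nat_le_iff by (simp only: H if_True occ of_nat_le_iff order_refl)
qed

end

lemma card_occupied: "finite (occupied H i) \<and> card (occupied H i) \<le> i"
  by (induction i) (auto simp: card_insert_if)

context bucket_levels begin

lemma sequence_free_slot:
  assumes "valid s" "finite occ" "card occ < n"
  shows "has_free_slot occ (sequence s)"
    "first_free occ (sequence s) < (\<Sum>j<L. w j) + n"
proof -
  have "\<not> {1..n} \<subseteq> occ"
    using card_mono[OF assms(2), of "{1..n}"] assms(3) by auto
  then obtain u where u: "u \<in> {1..n}" "u \<notin> occ" by blast
  then have "u \<in> set (probes s)"
    by (auto simp: probes_def)
  then obtain k where k: "k < length (probes s)" "probes s ! k = u"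
    by (auto simp: in_set_conv_nth)
  then have "sequence s k \<notin> occ"
    using sequence_probes[OF assms(1)] u by simp
  then show "has_free_slot occ (sequence s)"
    by (auto simp: has_free_slot_def)
  have "first_free occ (sequence s) \<le> k"
    unfolding first_free_def by (rule Least_le) fact
  then show "first_free occ (sequence s) < (\<Sum>j<L. w j) + n"
    using k length_probes by simp
qed

text \<open>The final sweep gives this crude bound in every run. It shows that each insertion
  succeeds and limits what an atypical run can add to an expectation.\<close>

lemma probe_complexity_le:
  assumes "valid s" "H i = sequence s" "i < n"
  shows "has_free_slot (occupied H i) (H i)" "probe_complexity H i \<le> of_nat ((\<Sum>j<L. w j) + n)"
proof -
  have "finite (occupied H i)" "card (occupied H i) < n"
    using card_occupied[of H i] assms(3) by auto
  note * = sequence_free_slot[OF assms(1) this]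
  show "has_free_slot (occupied H i) (H i)" using * assms(2) by simp
  then show "probe_complexity H i \<le> of_nat ((\<Sum>j<L. w j) + n)"
    using * assms(2) unfolding probe_complexity_def by (simp only: Suc_le_eq if_True of_nat_le_iff)
qed

section \<open>Counting attempts and arrivals\<close>

lemma sum_of_bool_eq_index:
  fixes f :: "nat \<Rightarrow> nat"
  assumes "x < N"
  shows "(\<Sum>y<N. f y * of_bool (P \<and> x = y)) = f x * of_bool P"
proof -
  have "(\<Sum>y<N. f y * of_bool (P \<and> x = y)) = (\<Sum>y<N. if y = x then f y * of_bool P else 0)"
    by (intro sum.cong) auto
  then show ?thesis using assms by (simp add: sum.delta)
qed

lemma arrivals_eq_sum_attempts:
  assumes "\<And>k. k < i \<Longrightarrow> valid (\<sigma> k)" "j < L"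
  shows "arrivals \<sigma> i j = (\<Sum>x<b j. attempts \<sigma> i j x)"
  using assms(1)
proof (induction i)
  case (Suc i)
  have "\<sigma> i j < b j" using Suc assms(2) by (simp add: valid_def)
  from sum_of_bool_eq_index[OF this, of "\<lambda>_. 1" "arrives \<sigma> i j"]
  show ?case using Suc by (simp add: arrivals_def sum.distrib)
qed (simp add: arrivals_def)

text \<open>Conservation of keys: a bucket keeps its first \<open>w j\<close> visitors, and all the
  others move on to the next level.\<close>

lemma arrivals_Suc_level:
  assumes "\<And>k. k < i \<Longrightarrow> valid (\<sigma> k)" "j < L"
  shows "arrivals \<sigma> i (Suc j) + (\<Sum>x<b j. min (w j) (attempts \<sigma> i j x)) = arrivals \<sigma> i j"
  using assms(1)
proof (induction i)
  case 0
  then show ?case by (simp add: arrivals_def)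
next
  case (Suc i)
  let ?A = "attempts \<sigma> i"
  have v: "\<sigma> i j < b j" using Suc assms(2) by (simp add: valid_def)
  have "(\<Sum>x<b j. min (w j) (attempts \<sigma> (Suc i) j x)) =
    (\<Sum>x<b j. min (w j) (?A j x) + of_bool (?A j x < w j) * of_bool (arrives \<sigma> i j \<and> \<sigma> i j = x))"
    by (intro sum.cong) auto
  also have "\<dots> = (\<Sum>x<b j. min (w j) (?A j x)) + of_bool (?A j (\<sigma> i j) < w j) * of_bool (arrives \<sigma> i j)"
    using sum_of_bool_eq_index[OF v, of "\<lambda>x. of_bool (?A j x < w j)"] by (simp add: sum.distrib)
  finally show ?case
    using Suc by (auto simp: arrivals_def reaches_Suc)
qed

text \<open>This is the predictability that \<open>nn_integral_prod_le_1\<close> demands; it also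
  allows the seed of one key to be resampled against a fixed history.\<close>

lemma attempts_cong: "(\<And>k. k < i \<Longrightarrow> \<sigma> k = \<sigma>' k) \<Longrightarrow> attempts \<sigma> i = attempts \<sigma>' i"
  by (induction i) auto

lemma arrivals_cong:
  assumes "\<And>k. k < i \<Longrightarrow> \<sigma> k = \<sigma>' k"
  shows "arrivals \<sigma> i = arrivals \<sigma>' i"
proof -
  have "arrives \<sigma> k j = arrives \<sigma>' k j" if "k < i" for k j
    using that assms attempts_cong[of k \<sigma> \<sigma>'] by auto
  then show ?thesis
    unfolding arrivals_def by (intro ext sum.cong) auto
qed

lemma arrivals_mono: "i \<le> i' \<Longrightarrow> arrivals \<sigma> i j \<le> arrivals \<sigma> i' j"
  unfolding arrivals_def by (intro sum_mono2) auto

lemma arrivals_level_antimono: "j \<le> j' \<Longrightarrow> arrivals \<sigma> i j' \<le> arrivals \<sigma> i j"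
  unfolding arrivals_def by (intro sum_mono) (auto dest: reaches_mono)

lemma arrivals_0 [simp]: "arrivals \<sigma> i 0 = i"
  by (simp add: arrivals_def)

end

section \<open>Concentration bounds for one level\<close>

lemma pmf_Markov:
  assumes "(\<integral>\<^sup>+x. f x \<partial>measure_pmf p) \<le> 1" "0 < c"
    and "\<And>x. x \<in> set_pmf p \<Longrightarrow> x \<in> E \<Longrightarrow> ennreal c \<le> f x"
  shows "measure_pmf.prob p E \<le> 1 / c"
proof -
  have "ennreal c * emeasure p E = (\<integral>\<^sup>+x. ennreal c * indicator E x \<partial>measure_pmf p)"
    by (simp add: nn_integral_cmult_indicator)
  also have "\<dots> \<le> (\<integral>\<^sup>+x. f x \<partial>measure_pmf p)"
    using assms(3) by (intro nn_integral_mono_AE) (auto simp: AE_measure_pmf_iff indicator_def)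
  also have "\<dots> \<le> 1" by fact
  finally have "ennreal (c * measure_pmf.prob p E) \<le> ennreal 1"
    using assms(2) by (simp add: measure_pmf.emeasure_eq_measure ennreal_mult)
  then have "c * measure_pmf.prob p E \<le> 1"
    by (subst (asm) ennreal_le_iff) auto
  then show ?thesis using assms(2) by (simp add: field_simps)
qed

text \<open>One term of the expansion of \<open>(y + 1) ^ N\<close>, together with
  \<open>y + 1 \<le> exp y\<close>. The parameter \<open>y\<close> will be the fraction
  \<open>k / N\<close> up to rounding.\<close>

lemma binomial_le_exp:
  assumes "0 < y"
  shows "real (N choose k) \<le> exp (y * real N) / y ^ k"
proof (cases "k \<le> N")
  case True
  have "real (N choose k) * y ^ k \<le> (\<Sum>i\<le>N. real (N choose i) * y ^ i)"
    using True assms by (intro member_le_sum[where f = "\<lambda>i. real (N choose i) * y ^ i"]) auto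
  also have "\<dots> = (y + 1) ^ N"
    by (simp add: binomial_ring)
  also have "\<dots> \<le> exp y ^ N"
    using assms exp_ge_add_one_self[of y] by (intro power_mono) (auto simp: add.commute)
  also have "\<dots> = exp (y * real N)"
    by (simp add: exp_of_nat2_mult)
  finally show ?thesis using assms by (simp add: field_simps)
qed (use assms in \<open>simp add: binomial_eq_0\<close>)

lemma exp_2_ge_4: "4 \<le> exp (2 :: real)"
proof -
  have "(2 :: real) \<le> exp 1" using exp_ge_add_one_self[of 1] by simp
  then have "2 * 2 \<le> exp 1 * exp (1 :: real)" by (intro mult_mono) auto
  then show ?thesis by (simp flip: exp_add)
qed

section \<open>Random seeds and the two tail bounds\<close>

context bucket_levels begin

definition seed :: "(nat \<Rightarrow> nat) pmf" where
  "seed = Pi_pmf {..<L} 0 (\<lambda>j. pmf_of_set {..<b j})"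

definition runs :: "nat \<Rightarrow> (nat \<Rightarrow> nat \<Rightarrow> nat) pmf" where
  "runs m = Pi_pmf {..<m} (\<lambda>_. 0) (\<lambda>_. seed)"

lemma set_pmf_bucket: "j < L \<Longrightarrow> set_pmf (pmf_of_set {..<b j}) = {..<b j}"
  using b_pos[of j] by (intro set_pmf_of_set) auto

lemma valid_seed: "s \<in> set_pmf seed \<Longrightarrow> valid s"
  using set_pmf_bucket by (auto simp: seed_def set_Pi_pmf PiE_dflt_def valid_def)

text \<open>There is no bound on \<open>k\<close>: beyond \<open>m\<close> the default seed picks
  bucket 0 everywhere, and that bucket exists by \<open>b_pos\<close>.\<close>

lemma valid_runs:
  assumes "\<sigma> \<in> set_pmf (runs m)"
  shows "valid (\<sigma> k)"
proof (cases "k < m")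
  case True
  then have "\<sigma> k \<in> set_pmf seed"
    using assms by (auto simp: runs_def set_Pi_pmf PiE_dflt_def)
  then show ?thesis by (rule valid_seed)
next
  case False
  then have "\<sigma> k = (\<lambda>_. 0)"
    using assms by (auto simp: runs_def set_Pi_pmf PiE_dflt_def)
  then show ?thesis using b_pos by (simp add: valid_def)
qed

text \<open>Deferred decision: \<open>Q\<close>, in use the event of reaching level
  \<open>j\<close>, ignores the choice made at \<open>j\<close>, so that choice is still uniform
  given \<open>Q\<close>. A weight of mean at most 1 over the buckets thus yields an admissible
  supermartingale factor, and keys that do not reach the level get weight 1.\<close>

lemma nn_integral_seed_level:
  fixes g :: "nat \<Rightarrow> ennreal"
  assumes "j < L" and Q: "\<And>s x. Q (s(j := x)) = Q s"
    and g: "(\<Sum>x<b j. g x) \<le> of_nat (b j)"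
  shows "(\<integral>\<^sup>+s. (if Q s then g (s j) else 1) \<partial>measure_pmf seed) \<le> 1"
  unfolding seed_def
proof (rule nn_integral_Pi_pmf_le[where i = j])
  fix s
  have "(\<integral>\<^sup>+x. g x \<partial>measure_pmf (pmf_of_set {..<b j})) = (\<Sum>x<b j. g x) / of_nat (b j)"
    using b_pos[OF assms(1)] by (subst nn_integral_pmf_of_set) auto
  also have "\<dots> \<le> of_nat (b j) / of_nat (b j)"
    using g by (intro divide_right_mono_ennreal)
  also have "\<dots> = 1"
    using b_pos[OF assms(1)] by (intro ennreal_divide_self) (auto simp: of_nat_less_top)
  finally show "(\<integral>\<^sup>+x. (if Q (s(j := x)) then g ((s(j := x)) j) else 1) \<partial>measure_pmf (pmf_of_set {..<b j})) \<le> 1"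
    by (cases "Q s") (simp_all add: Q measure_pmf.emeasure_space_1)
qed (use assms in auto)

lemma prob_seed_le:
  assumes J: "J \<subseteq> {..<L}" and B: "\<And>j. j \<in> J \<Longrightarrow> real (card ({..<b j} \<inter> B j)) \<le> \<rho> j * real (b j)"
  shows "measure_pmf.prob seed {s. \<forall>j\<in>J. s j \<in> B j} \<le> (\<Prod>j\<in>J. \<rho> j)"
proof -
  define B' where "B' = (\<lambda>j. if j \<in> J then B j else UNIV)"
  have "{s. \<forall>j\<in>J. s j \<in> B j} = Pi {..<L} B'"
    using J by (auto simp: B'_def Pi_def)
  then have "measure_pmf.prob seed {s. \<forall>j\<in>J. s j \<in> B j} =
      (\<Prod>j<L. measure_pmf.prob (pmf_of_set {..<b j}) (B' j))"
    unfolding seed_def by (simp add: measure_Pi_pmf_Pi)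
  also have "\<dots> = (\<Prod>j\<in>J. measure_pmf.prob (pmf_of_set {..<b j}) (B' j))"
    using J by (intro prod.mono_neutral_right) (auto simp: B'_def)
  also have "\<dots> \<le> (\<Prod>j\<in>J. \<rho> j)"
  proof (intro prod_mono conjI)
    fix j assume "j \<in> J"
    then have b: "0 < b j" and B': "B' j = B j"
      using J b_pos by (auto simp: B'_def)
    then have "measure_pmf.prob (pmf_of_set {..<b j}) (B' j) = card ({..<b j} \<inter> B j) / b j"
      by (subst measure_pmf_of_set) auto
    then show "measure_pmf.prob (pmf_of_set {..<b j}) (B' j) \<le> \<rho> j"
      using B[OF \<open>j \<in> J\<close>] b by (simp add: divide_le_eq)
  qed auto
  finally show ?thesis .
qed

lemma reaches_upd: "i \<le> j \<Longrightarrow> reaches A (s(j := x)) i = reaches A s i"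
  by (auto simp: reaches_def)

text \<open>The earlier keys fix the full buckets, and key \<open>i\<close> chooses independently at
  each level; to reach \<open>t\<close> it must hit a full bucket on every level from
  \<open>a\<close> on. \<open>G\<close> has to ignore the seed of key \<open>i\<close>, so that
  conditioning on it leaves that seed uniform.\<close>

lemma prob_arrives_le:
  fixes G :: "(nat \<Rightarrow> nat \<Rightarrow> nat) \<Rightarrow> bool"
  assumes "i < m" "t \<le> L"
    and G: "\<And>\<sigma> s. G (\<sigma>(i := s)) = G \<sigma>"
    and full: "\<And>\<sigma> j. (\<And>k. k < i \<Longrightarrow> valid (\<sigma> k)) \<Longrightarrow> G \<sigma> \<Longrightarrow> a \<le> j \<Longrightarrow> j < t \<Longrightarrow>
           real (card {x\<in>{..<b j}. w j \<le> attempts \<sigma> i j x}) \<le> \<rho> j * real (b j)"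
    and \<rho>: "\<And>j. 0 \<le> \<rho> j"
  shows "measure_pmf.prob (runs m) {\<sigma>. G \<sigma> \<and> arrives \<sigma> i t} \<le> (\<Prod>j=a..<t. \<rho> j)"
proof -
  have "emeasure (runs m) {\<sigma>. G \<sigma> \<and> arrives \<sigma> i t}
      = (\<integral>\<^sup>+\<sigma>. indicator {\<sigma>. G \<sigma> \<and> arrives \<sigma> i t} \<sigma> \<partial>runs m)"
    by simp
  also have "\<dots> \<le> ennreal (\<Prod>j=a..<t. \<rho> j)"
    unfolding runs_def
  proof (rule nn_integral_Pi_pmf_le[where i = i])
    fix \<sigma> assume "\<And>k. k \<in> {..<m} \<Longrightarrow> \<sigma> k \<in> set_pmf seed"
    then have v: "valid (\<sigma> k)" if "k < i" for k
      using that assms(1) valid_seed by auto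
    have att: "attempts (\<sigma>(i := s)) i = attempts \<sigma> i" for s
      by (rule attempts_cong) auto
    define B where "B = (\<lambda>j. {x. w j \<le> attempts \<sigma> i j x})"
    have "(\<integral>\<^sup>+s. indicator {\<sigma>. G \<sigma> \<and> arrives \<sigma> i t} (\<sigma>(i := s)) \<partial>measure_pmf seed)
       \<le> (\<integral>\<^sup>+s. indicator {s. G \<sigma> \<and> (\<forall>j\<in>{a..<t}. s j \<in> B j)} s \<partial>measure_pmf seed)"
      using att G by (intro nn_integral_mono) (auto simp: indicator_def reaches_def B_def)
    also have "\<dots> = emeasure seed {s. G \<sigma> \<and> (\<forall>j\<in>{a..<t}. s j \<in> B j)}"
      by simp
    also have "\<dots> \<le> ennreal (\<Prod>j=a..<t. \<rho> j)"
    proof (cases "G \<sigma>")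
      case True
      have "measure_pmf.prob seed {s. \<forall>j\<in>{a..<t}. s j \<in> B j} \<le> (\<Prod>j=a..<t. \<rho> j)"
      proof (rule prob_seed_le)
        fix j assume j: "j \<in> {a..<t}"
        have "{..<b j} \<inter> B j = {x\<in>{..<b j}. w j \<le> attempts \<sigma> i j x}"
          by (auto simp: B_def)
        then show "real (card ({..<b j} \<inter> B j)) \<le> \<rho> j * real (b j)"
          using full[OF v True, of j] j by simp
      qed (use assms in auto)
      then show ?thesis using True by (simp add: measure_pmf.emeasure_eq_measure ennreal_leI)
    qed simp
    finally show "(\<integral>\<^sup>+s. indicator {\<sigma>. G \<sigma> \<and> arrives \<sigma> i t} (\<sigma>(i := s)) \<partial>measure_pmf seed)
       \<le> ennreal (\<Prod>j=a..<t. \<rho> j)" .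
  qed (use assms in auto)
  finally show ?thesis
    by (simp add: measure_pmf.emeasure_eq_measure ennreal_le_iff prod_nonneg \<rho>)
qed

text \<open>
  Each attempt has weight \<open>1/2\<close> if it hits \<open>S\<close> and 1 otherwise, divided by the mean \<open>q\<close>; few hits
  among many attempts make the product of the weights large.
\<close>

lemma prob_few_attempts_in:
  assumes j: "j < L" and S: "S \<subseteq> {..<b j}"
  shows "measure_pmf.prob (runs m) {\<sigma>. 4 * b j * w j \<le> arrivals \<sigma> m j \<and>
           (\<Sum>x\<in>S. attempts \<sigma> m j x) \<le> card S * w j} \<le> 1 / 2 ^ (card S * w j)"
proof -
  define k where "k = card S"
  define q where "q = 1 - real k / (2 * real (b j))"
  have b: "0 < real (b j)" using b_pos[OF j] by simp
  have fin: "finite S" using S finite_subset by blast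
  have kb: "k \<le> b j" unfolding k_def using card_mono[OF _ S] by simp
  have q: "1 / 2 \<le> q" "q \<le> 1"
    using kb b unfolding q_def by (auto simp: field_simps)
  define F where "F = (\<lambda>i \<sigma> s. if reaches (attempts \<sigma> i) s j
     then ennreal ((if s j \<in> S then 1 / 2 else 1) / q) else 1)"
  have int: "(\<integral>\<^sup>+\<sigma>. (\<Prod>i<m. F i \<sigma> (\<sigma> i)) \<partial>runs m) \<le> 1"
    unfolding runs_def
  proof (rule nn_integral_prod_le_1)
    fix i and \<sigma> \<sigma>' :: "nat \<Rightarrow> nat \<Rightarrow> nat" and s :: "nat \<Rightarrow> nat"
    assume "\<And>k. k < i \<Longrightarrow> \<sigma> k = \<sigma>' k"
    then have "attempts \<sigma> i = attempts \<sigma>' i" by (rule attempts_cong)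
    then show "F i \<sigma> s = F i \<sigma>' s" by (simp add: F_def)
  next
    fix i \<sigma>
    show "(\<integral>\<^sup>+s. F i \<sigma> s \<partial>measure_pmf seed) \<le> 1"
      unfolding F_def
    proof (rule nn_integral_seed_level[OF j, where g = "\<lambda>x. ennreal ((if x \<in> S then 1 / 2 else 1) / q)"])
      have "(\<Sum>x<b j. (if x \<in> S then 1 / 2 else 1) :: real) = (\<Sum>x<b j. 1 - (if x \<in> S then 1 / 2 else 0))"
        by (intro sum.cong) auto
      also have "\<dots> = real (b j) - k / 2"
        using S fin by (simp add: sum_subtractf sum.If_cases k_def Int_absorb1)
      also have "\<dots> = real (b j) * q"
        using b by (simp add: q_def field_simps)
      finally have "(\<Sum>x<b j. (if x \<in> S then 1 / 2 else 1) / q) = real (b j)"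
        using q by (simp flip: sum_divide_distrib)
      then have "(\<Sum>x<b j. ennreal ((if x \<in> S then 1 / 2 else 1) / q)) = ennreal (real (b j))"
        using q by (subst sum_ennreal) auto
      then show "(\<Sum>x<b j. ennreal ((if x \<in> S then 1 / 2 else 1) / q)) \<le> of_nat (b j)"
        by simp
    qed (simp add: reaches_upd)
  qed
  have prod: "(\<Prod>i<m. F i \<sigma> (\<sigma> i)) = ennreal ((1 / 2) ^ (\<Sum>x\<in>S. attempts \<sigma> m j x) * (1 / q) ^ arrivals \<sigma> m j)"
    for \<sigma>
  proof (induction m)
    case (Suc m)
    have "(\<Sum>x\<in>S. attempts \<sigma> (Suc m) j x) = (\<Sum>x\<in>S. attempts \<sigma> m j x)
       + of_bool (arrives \<sigma> m j \<and> \<sigma> m j \<in> S)"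
      using fin by (cases "arrives \<sigma> m j") (auto simp: sum.distrib of_bool_def sum.delta)
    moreover have "arrivals \<sigma> (Suc m) j = arrivals \<sigma> m j + of_bool (arrives \<sigma> m j)"
      by (simp add: arrivals_def)
    ultimately show ?case
      using Suc q by (auto simp: F_def ennreal_mult[symmetric])
  qed (simp add: arrivals_def)
  have "measure_pmf.prob (runs m) {\<sigma>. 4 * b j * w j \<le> arrivals \<sigma> m j \<and>
           (\<Sum>x\<in>S. attempts \<sigma> m j x) \<le> card S * w j} \<le> 1 / 2 ^ (k * w j)"
  proof (rule pmf_Markov[OF int])
    fix \<sigma> assume "\<sigma> \<in> {\<sigma>. 4 * b j * w j \<le> arrivals \<sigma> m j \<and>
           (\<Sum>x\<in>S. attempts \<sigma> m j x) \<le> card S * w j}"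
    then have \<sigma>: "4 * b j * w j \<le> arrivals \<sigma> m j" "(\<Sum>x\<in>S. attempts \<sigma> m j x) \<le> k * w j"
      by (auto simp: k_def)
    \<comment> \<open>Here the fourfold load enters: \<open>4 * b j * w j\<close> factors
      \<open>1 / q\<close> multiply to at least \<open>4 ^ (k * w j)\<close>, while few hits in
      \<open>S\<close> cost at most \<open>2 ^ (k * w j)\<close>.\<close>
    have "exp (k / (2 * b j)) \<le> 1 / q"
      using exp_ge_add_one_self[of "- (k / (2 * b j))"] q by (simp add: q_def exp_minus field_simps)
    then have "exp (k / (2 * b j)) ^ (4 * b j * w j) \<le> (1 / q) ^ (4 * b j * w j)"
      by (intro power_mono) auto
    also have "\<dots> \<le> (1 / q) ^ arrivals \<sigma> m j"
      using q \<sigma> by (intro power_increasing) (auto simp: field_simps)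
    also have "exp (k / (2 * b j)) ^ (4 * b j * w j) = exp 2 ^ (k * w j)"
      using b by (simp flip: exp_of_nat_mult)
    finally have "4 ^ (k * w j) \<le> (1 / q) ^ arrivals \<sigma> m j"
      using power_mono[OF exp_2_ge_4, of "k * w j"] by simp
    moreover have "(1 / 2) ^ (k * w j) \<le> (1 / 2 :: real) ^ (\<Sum>x\<in>S. attempts \<sigma> m j x)"
      using \<sigma> by (intro power_decreasing) auto
    ultimately have "(1 / 2) ^ (k * w j) * 4 ^ (k * w j)
        \<le> (1 / 2) ^ (\<Sum>x\<in>S. attempts \<sigma> m j x) * (1 / q) ^ arrivals \<sigma> m j"
      by (intro mult_mono) auto
    moreover have "(1 / 2) ^ (k * w j) * 4 ^ (k * w j) = (2 :: real) ^ (k * w j)"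
      by (simp flip: power_mult_distrib)
    ultimately show "ennreal (2 ^ (k * w j)) \<le> (\<Prod>i<m. F i \<sigma> (\<sigma> i))"
      unfolding prod by (intro ennreal_leI) simp
  qed simp
  then show ?thesis by (simp add: k_def)
qed

text \<open>Union bound over the \<open>k\<close>-element sets of buckets: if all buckets of
  \<open>S\<close> are underfull, they share at most \<open>card S * w j\<close> attempts.\<close>

lemma prob_many_underfull:
  assumes j: "j < L"
  shows "measure_pmf.prob (runs m) {\<sigma>. 4 * b j * w j \<le> arrivals \<sigma> m j \<and>
           k \<le> card {x\<in>{..<b j}. attempts \<sigma> m j x < w j}} \<le> (b j choose k) / 2 ^ (k * w j)"
    (is "measure_pmf.prob _ ?E \<le> _")
proof -
  let ?S = "{S. S \<subseteq> {..<b j} \<and> card S = k}"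
  let ?E' = "\<lambda>S. {\<sigma>. 4 * b j * w j \<le> arrivals \<sigma> m j \<and> (\<Sum>x\<in>S. attempts \<sigma> m j x) \<le> card S * w j}"
  have fin: "finite ?S" by simp
  have "?E \<subseteq> (\<Union>S\<in>?S. ?E' S)"
  proof
    fix \<sigma> assume \<sigma>: "\<sigma> \<in> ?E"
    then obtain S where S: "S \<subseteq> {x\<in>{..<b j}. attempts \<sigma> m j x < w j}" "card S = k"
      by (auto elim: obtain_subset_with_card_n)
    then have "(\<Sum>x\<in>S. attempts \<sigma> m j x) \<le> card S * w j"
      by (intro sum_bounded_above[where 'a = nat, simplified]) (auto intro: less_imp_le)
    then show "\<sigma> \<in> (\<Union>S\<in>?S. ?E' S)" using \<sigma> S by auto
  qed
  then have "measure_pmf.prob (runs m) ?E \<le> measure_pmf.prob (runs m) (\<Union>S\<in>?S. ?E' S)"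
    by (intro measure_pmf.finite_measure_mono) auto
  also have "\<dots> \<le> (\<Sum>S\<in>?S. measure_pmf.prob (runs m) (?E' S))"
    using fin by (intro measure_UNION_le) auto
  also have "\<dots> \<le> (\<Sum>S\<in>?S. 1 / 2 ^ (k * w j))"
    using prob_few_attempts_in[OF j] by (intro sum_mono) auto
  also have "\<dots> = (b j choose k) / 2 ^ (k * w j)"
    using n_subsets[of "{..<b j}" k] by simp
  finally show ?thesis .
qed

text \<open>With \<open>k = b j div E\<close> the number of sets is at most
  \<open>3 * (3 * E) ^ k\<close>, and \<open>2 ^ (k * w j)\<close> is at least
  \<open>(8 * E) ^ k\<close>, which wins because 3/8 is below 1/2. For \<open>E = 2 ^ l\<close> the
  hypothesis on \<open>E\<close> is exactly what the width \<open>l + 3\<close> provides.\<close>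

lemma prob_many_underfull_fraction:
  assumes j: "j < L" and E: "0 < E" "8 * E \<le> 2 ^ w j"
  shows "measure_pmf.prob (runs m) {\<sigma>. 4 * b j * w j \<le> arrivals \<sigma> m j \<and>
           b j div E \<le> card {x\<in>{..<b j}. attempts \<sigma> m j x < w j}} \<le> 3 / 2 ^ (b j div E)"
proof -
  let ?k = "b j div E"
  have "real (b j choose ?k) \<le> exp (1 / real E * b j) / (1 / real E) ^ ?k"
    using E by (intro binomial_le_exp) auto
  also have "\<dots> = exp (b j / E) * real E ^ ?k"
    by (simp add: field_simps)
  \<comment> \<open>Rounding down in \<open>b j div E\<close> costs a single factor
    \<open>exp 1\<close>.\<close>
  also have "exp (b j / E) \<le> exp (1 + real ?k)"
  proof -
    have "b j = ?k * E + b j mod E" by simp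
    also have "\<dots> \<le> ?k * E + E"
      using E by (intro add_left_mono) (auto intro: less_imp_le)
    finally have "real (b j) \<le> real (?k * E + E)" by (rule of_nat_mono)
    then show ?thesis using E by (simp add: field_simps)
  qed
  also have "exp (1 + real ?k) = exp 1 * exp 1 ^ ?k"
    by (simp add: exp_add flip: exp_of_nat_mult)
  also have "\<dots> \<le> 3 * 3 ^ ?k"
    using exp_le by (intro mult_mono power_mono) auto
  finally have "real (b j choose ?k) \<le> 3 * 3 ^ ?k * real E ^ ?k"
    by (simp add: mult_right_mono)
  moreover have "(8 * real E) ^ ?k \<le> 2 ^ (?k * w j)"
  proof -
    have "real (8 * E) \<le> real (2 ^ w j)" using E(2) by (rule of_nat_mono)
    then have "(8 * real E) ^ ?k \<le> (2 ^ w j) ^ ?k" by (intro power_mono) auto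
    then show ?thesis by (simp add: power_mult mult.commute)
  qed
  ultimately have "(b j choose ?k) / 2 ^ (?k * w j) \<le> (3 * 3 ^ ?k * real E ^ ?k) / (8 * real E) ^ ?k"
    using E by (intro frac_le) auto
  also have "\<dots> = 3 * (3 / 8) ^ ?k"
    using E by (simp add: power_mult_distrib power_divide)
  also have "\<dots> \<le> 3 * (1 / 2) ^ ?k"
    by (intro mult_left_mono power_mono) auto
  finally show ?thesis
    using prob_many_underfull[OF j, of m ?k] by (simp add: power_divide)
qed

text \<open>A full bucket has seen at least one attempt. Nothing is lost by this crude count, since
  it is applied to levels of width 1.\<close>

lemma card_full_le_arrivals:
  assumes "\<And>k. k < i \<Longrightarrow> valid (\<sigma> k)" "j < L" "0 < w j"
  shows "card {x\<in>{..<b j}. w j \<le> attempts \<sigma> i j x} \<le> arrivals \<sigma> i j"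
proof -
  have "card {x\<in>{..<b j}. w j \<le> attempts \<sigma> i j x} = (\<Sum>x<b j. of_bool (w j \<le> attempts \<sigma> i j x))"
    by (simp add: Int_def conj_commute)
  also have "\<dots> \<le> (\<Sum>x<b j. attempts \<sigma> i j x)"
    using assms(3) by (intro sum_mono) auto
  also have "\<dots> = arrivals \<sigma> i j"
    using arrivals_eq_sum_attempts[OF assms(1,2)] by simp
  finally show ?thesis .
qed

text \<open>
  Weight 2 for every key that goes on.  Weights are truncated to 1 once more than \<open>M\<close> keys have
  arrived: this keeps the conditional mean at most 1, as at most \<open>M\<close> buckets are full before.
\<close>

lemma prob_many_overflow:
  fixes M M' :: real
  assumes j: "j < L" and w: "0 < w j" and M: "0 \<le> M"
  shows "measure_pmf.prob (runs m) {\<sigma>. arrivals \<sigma> m j \<le> M \<and> M' \<le> arrivals \<sigma> m (Suc j)}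
       \<le> exp (M\<^sup>2 / b j) / 2 powr M'"
proof -
  define p where "p = M / b j"
  have b: "0 < real (b j)" using b_pos[OF j] by simp
  have p: "0 \<le> p" using M by (simp add: p_def)
  define F where "F = (\<lambda>i \<sigma> s. if reaches (attempts \<sigma> i) s j \<and> arrivals \<sigma> i j \<le> M
     then ennreal ((if w j \<le> attempts \<sigma> i j (s j) then 2 else 1) / (1 + p)) else 1)"
  have int: "(\<integral>\<^sup>+\<sigma>. (\<Prod>i<m. F i \<sigma> (\<sigma> i)) \<partial>runs m) \<le> 1"
    unfolding runs_def
  proof (rule nn_integral_prod_le_1)
    fix i and \<sigma> \<sigma>' :: "nat \<Rightarrow> nat \<Rightarrow> nat" and s :: "nat \<Rightarrow> nat"
    assume "\<And>k. k < i \<Longrightarrow> \<sigma> k = \<sigma>' k"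
    then have "attempts \<sigma> i = attempts \<sigma>' i" "arrivals \<sigma> i = arrivals \<sigma>' i"
      using attempts_cong arrivals_cong by blast+
    then show "F i \<sigma> s = F i \<sigma>' s" by (simp add: F_def)
  next
    fix i :: nat and \<sigma> assume "\<And>k. k < i \<Longrightarrow> \<sigma> k \<in> set_pmf seed"
    then have v: "valid (\<sigma> k)" if "k < i" for k using that valid_seed by blast
    show "(\<integral>\<^sup>+s. F i \<sigma> s \<partial>measure_pmf seed) \<le> 1"
    proof (cases "arrivals \<sigma> i j \<le> M")
      case True
      let ?g = "\<lambda>x. (if w j \<le> attempts \<sigma> i j x then 2 else 1) / (1 + p)"
      have "(\<integral>\<^sup>+s. (if reaches (attempts \<sigma> i) s j then ennreal (?g (s j)) else 1) \<partial>measure_pmf seed) \<le> 1"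
      proof (rule nn_integral_seed_level[OF j, where g = "\<lambda>x. ennreal (?g x)"])
        have "(\<Sum>x<b j. (if w j \<le> attempts \<sigma> i j x then 2 else 1) :: real)
            = (\<Sum>x<b j. 1 + of_bool (w j \<le> attempts \<sigma> i j x))"
          by (intro sum.cong) auto
        also have "\<dots> = real (b j) + real (card {x\<in>{..<b j}. w j \<le> attempts \<sigma> i j x})"
          by (simp add: sum.distrib Int_def conj_commute)
        also have "\<dots> \<le> real (b j) + M"
          using card_full_le_arrivals[of i \<sigma> j] v j w True by force
        also have "\<dots> = real (b j) * (1 + p)"
          using b by (simp add: p_def field_simps)
        finally have "(\<Sum>x<b j. ?g x) \<le> real (b j)"
          using p by (simp add: field_simps flip: sum_divide_distrib)
        moreover have "(\<Sum>x<b j. ennreal (?g x)) = ennreal (\<Sum>x<b j. ?g x)"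
          using p by (intro sum_ennreal) auto
        ultimately show "(\<Sum>x<b j. ennreal (?g x)) \<le> of_nat (b j)"
          by (simp add: ennreal_leI flip: ennreal_of_nat_eq_real_of_nat)
      qed (simp add: reaches_upd)
      then show ?thesis using True by (simp add: F_def)
    qed (simp add: F_def measure_pmf.emeasure_space_1)
  qed
  \<comment> \<open>Arrivals only grow with time, so if the final count is at most \<open>M\<close>,
    the truncation never acted and the product has this closed form.\<close>
  have prod: "(\<Prod>i<m. F i \<sigma> (\<sigma> i)) = ennreal (2 ^ arrivals \<sigma> m (Suc j) * (1 / (1 + p)) ^ arrivals \<sigma> m j)"
    if "arrivals \<sigma> m j \<le> M" for \<sigma>
    using that
  proof (induction m)
    case (Suc m)
    have "arrivals \<sigma> m j \<le> M"
      using Suc.prems arrivals_mono[of m "Suc m" \<sigma> j] by linarith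
    moreover have "arrivals \<sigma> (Suc m) j = arrivals \<sigma> m j + of_bool (arrives \<sigma> m j)"
      "arrivals \<sigma> (Suc m) (Suc j) = arrivals \<sigma> m (Suc j)
        + of_bool (arrives \<sigma> m j \<and> w j \<le> attempts \<sigma> m j (\<sigma> m j))"
      by (simp_all add: arrivals_def reaches_Suc)
    ultimately show ?case
      using Suc p by (auto simp: F_def ennreal_mult[symmetric] field_simps)
  qed (simp add: arrivals_def)
  have "measure_pmf.prob (runs m) {\<sigma>. arrivals \<sigma> m j \<le> M \<and> M' \<le> arrivals \<sigma> m (Suc j)}
       \<le> 1 / (2 powr M' * exp (- (p * M)))"
  proof (rule pmf_Markov[OF int])
    fix \<sigma> assume "\<sigma> \<in> {\<sigma>. arrivals \<sigma> m j \<le> M \<and> M' \<le> arrivals \<sigma> m (Suc j)}"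
    then have \<sigma>: "arrivals \<sigma> m j \<le> M" "M' \<le> arrivals \<sigma> m (Suc j)" by auto
    have "2 powr M' \<le> 2 powr real (arrivals \<sigma> m (Suc j))"
      using \<sigma> by (intro powr_mono) auto
    also have "\<dots> = 2 ^ arrivals \<sigma> m (Suc j)" by (simp add: powr_realpow)
    finally have 1: "2 powr M' \<le> 2 ^ arrivals \<sigma> m (Suc j)" .
    \<comment> \<open>The normalisations lose at most \<open>exp (p * M)\<close>, as there are at
      most \<open>M\<close> of them and \<open>1 + p \<le> exp p\<close>.\<close>
    have "exp (- (p * M)) \<le> exp (- (p * arrivals \<sigma> m j))"
      using \<sigma> p by (simp add: mult_left_mono)
    also have "\<dots> = exp (- p) ^ arrivals \<sigma> m j"
      by (simp flip: exp_of_nat_mult add: mult.commute)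
    also have "\<dots> \<le> (1 / (1 + p)) ^ arrivals \<sigma> m j"
      using p exp_ge_add_one_self[of p] by (intro power_mono) (auto simp: exp_minus field_simps)
    finally have "2 powr M' * exp (- (p * M)) \<le> 2 ^ arrivals \<sigma> m (Suc j) * (1 / (1 + p)) ^ arrivals \<sigma> m j"
      using 1 by (intro mult_mono) auto
    then show "ennreal (2 powr M' * exp (- (p * M))) \<le> (\<Prod>i<m. F i \<sigma> (\<sigma> i))"
      using prod[OF \<sigma>(1)] by (simp add: ennreal_leI)
  qed simp
  also have "\<dots> = exp (M\<^sup>2 / b j) / 2 powr M'"
    by (simp add: exp_minus p_def power2_eq_square field_simps)
  finally show ?thesis .
qed

end

section \<open>Funnel sizes\<close>

lemma nat_div_bounds:
  fixes a k :: nat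
  assumes "0 < k"
  shows "real (a div k) \<le> a / k" "a / k < real (a div k) + 1"
proof -
  have "real (a div k) = of_int \<lfloor>real a / real k\<rfloor>"
    by (simp add: floor_divide_of_nat_eq)
  then show "real (a div k) \<le> a / k" "a / k < real (a div k) + 1"
    by linarith+
qed

primrec rest :: "nat \<Rightarrow> nat \<Rightarrow> nat \<Rightarrow> nat" where
  "rest n l 0 = n"
| "rest n l (Suc j) = rest n l j - (l + 3) * (rest n l j div (512 * (l + 3)))"

definition funnel_buckets :: "nat \<Rightarrow> nat \<Rightarrow> nat \<Rightarrow> nat" where
  "funnel_buckets n l j = (if j < 512 * l then rest n l j div (512 * (l + 3))
     else rest n l (512 * l) div 2 ^ (j - 512 * l + 1))"

definition funnel_width :: "nat \<Rightarrow> nat \<Rightarrow> nat" where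
  "funnel_width l j = (if j < 512 * l then l + 3 else 1)"

text \<open>\<open>D\<close> slots are spared and \<theta> is the exponent of the concentration
  bounds. \<open>D_ge\<close> pays for the remainder and the holes, \<open>l_small\<close> makes
  rounding negligible, \<open>\<theta>_funnel\<close> gives each funnel level at least
  \<open>\<theta> * 2 ^ l\<close> buckets, and \<open>\<theta>_overflow\<close> makes \<theta> at
  most a \<open>1 / sqrt n\<close> fraction of every overflow level. The factors
  \<open>4 ^ l\<close> come from the lower bound \<open>n / 4 ^ l\<close> on the slots behind the
  funnel.\<close>

locale funnel =
  fixes n l h m D :: nat and \<theta> :: real
  assumes n_ge: "16 \<le> n"
    and l_pos: "1 \<le> l"
    and h_pos: "1 \<le> h"
    and m_le: "m + D \<le> n"
    and D_ge: "3 * n \<le> D * 2 ^ l"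
    and l_small: "512 * 512 * (l + 3) * 2 ^ l \<le> n"
    and \<theta>_funnel: "4 ^ l * (512 * (real l + 3) * 2 ^ l) * (\<theta> + 2) \<le> n"
    and \<theta>_overflow: "4 ^ l * \<theta> * 2 ^ (2 * h + 2) * sqrt n \<le> n"
    and \<theta>_ge: "1 \<le> \<theta>"
    and h_ge: "n \<le> 2 ^ (2 ^ h)"
begin

lemma \<theta>_pos: "0 < \<theta>"
  using \<theta>_ge by simp

definition "\<alpha> = 512 * l"
definition "\<beta> = l + 3"

abbreviation "R \<equiv> rest n l"
abbreviation "b \<equiv> funnel_buckets n l"
abbreviation "w \<equiv> funnel_width l"

lemma beta_pos: "0 < \<beta>" by (simp add: \<beta>_def)

lemma b_funnel: "j < \<alpha> \<Longrightarrow> b j = R j div (512 * \<beta>)"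
  and b_overflow: "b (\<alpha> + t) = R \<alpha> div 2 ^ (t + 1)"
  and w_funnel: "j < \<alpha> \<Longrightarrow> w j = \<beta>"
  and w_overflow: "w (\<alpha> + t) = 1"
  by (simp_all add: \<alpha>_def \<beta>_def funnel_buckets_def funnel_width_def)

lemma rest_Suc: "R (Suc j) = R j - \<beta> * (R j div (512 * \<beta>))"
  by (simp add: \<beta>_def)

lemma level_le_rest: "512 * (\<beta> * (R j div (512 * \<beta>))) \<le> R j"
  using div_times_less_eq_dividend[of "R j" "512 * \<beta>"] by (simp add: ac_simps)

lemma rest_add_level: "R (Suc j) + \<beta> * (R j div (512 * \<beta>)) = R j"
  using level_le_rest[of j] by (simp only: rest_Suc)

lemma rest_antimono: "i \<le> j \<Longrightarrow> R j \<le> R i"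
proof (induction j rule: nat_induct_at_least)
  case (Suc j)
  then show ?case using rest_add_level[of j] by linarith
qed simp

lemma rest_ge: "n * (511 / 512) ^ j \<le> R j"
proof (induction j)
  case (Suc j)
  have "512 * real (R (Suc j)) \<ge> 511 * real (R j)"
    using rest_add_level[of j] level_le_rest[of j] by linarith
  then show ?case using Suc by simp
qed simp

text \<open>Rounding loses less than one bucket per level, so one step is bounded by the map
  \<open>x \<mapsto> 511 / 512 * x + \<beta>\<close>, whose fixed point is
  \<open>512 * \<beta>\<close>.\<close>

lemma rest_le: "R j \<le> n * (511 / 512) ^ j + 512 * \<beta>"
proof (induction j)
  case (Suc j)
  have "real (R j) / real (512 * \<beta>) < real (R j div (512 * \<beta>)) + 1"
    using beta_pos by (intro nat_div_bounds) auto
  then have "R j / 512 < \<beta> * real (R j div (512 * \<beta>)) + \<beta>"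
    using beta_pos by (simp add: field_simps)
  moreover have "real (R (Suc j)) + \<beta> * real (R j div (512 * \<beta>)) = R j"
    using rest_add_level[of j] by (metis of_nat_add of_nat_mult)
  ultimately have "real (R (Suc j)) \<le> 511 / 512 * R j + \<beta>" by linarith
  also have "\<dots> \<le> 511 / 512 * (n * (511 / 512) ^ j + 512 * \<beta>) + \<beta>"
    using Suc by simp
  also have "\<dots> = n * (511 / 512) ^ Suc j + 512 * \<beta>" by simp
  finally show ?case .
qed simp

text \<open>Up to rounding, each block of 512 levels divides the remainder by a number between 2 and
  4. The lower bound squares a 256th power because Bernoulli's inequality at exponent 512 would only
  give 0; the upper bound applies it to the reciprocal.\<close>

lemma power_512_bounds: "1 / 4 \<le> (511 / 512 :: real) ^ 512" "(511 / 512 :: real) ^ 512 \<le> 1 / 2"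
proof -
  have "1 + real 256 * (- 1 / 512) \<le> (1 + (- 1 / 512 :: real)) ^ 256"
    by (rule Bernoulli_inequality) simp
  then have "1 / 2 \<le> (511 / 512 :: real) ^ 256" by simp
  then have "(1 / 2) ^ 2 \<le> ((511 / 512 :: real) ^ 256) ^ 2"
    by (intro power_mono) auto
  then show "1 / 4 \<le> (511 / 512 :: real) ^ 512"
    by (simp only: flip: power_mult) (simp add: power2_eq_square)
  have "1 + real 512 * (1 / 511) \<le> (1 + (1 / 511 :: real)) ^ 512"
    by (rule Bernoulli_inequality) simp
  then have "2 \<le> (512 / 511 :: real) ^ 512" by simp
  moreover have "(511 / 512 :: real) ^ 512 * (512 / 511) ^ 512 = 1"
    by (simp flip: power_mult_distrib)
  moreover have "(511 / 512 :: real) ^ 512 * 2 \<le> (511 / 512) ^ 512 * (512 / 511) ^ 512"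
    using calculation(1) by (intro mult_left_mono) auto
  ultimately show "(511 / 512 :: real) ^ 512 \<le> 1 / 2" by linarith
qed

lemma rest_alpha_ge: "n / 4 ^ l \<le> R \<alpha>"
proof -
  have "(1 / 4) ^ l \<le> ((511 / 512 :: real) ^ 512) ^ l"
    using power_512_bounds by (intro power_mono) auto
  then have "n * (1 / 4) ^ l \<le> n * (511 / 512 :: real) ^ \<alpha>"
    unfolding \<alpha>_def power_mult by (intro mult_left_mono) auto
  also have "\<dots> \<le> R \<alpha>" by (rule rest_ge)
  finally show ?thesis by (simp add: power_divide)
qed

lemma l_small': "512 * 512 * real \<beta> * 2 ^ l \<le> n"
proof -
  have "real (512 * 512 * (l + 3) * 2 ^ l) \<le> real n" using l_small by (rule of_nat_mono)
  then show ?thesis by (simp add: \<beta>_def)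
qed

lemma rest_alpha_le: "R \<alpha> \<le> 2 * n / 2 ^ l"
proof -
  have "R \<alpha> \<le> n * ((511 / 512 :: real) ^ 512) ^ l + 512 * \<beta>"
    using rest_le[of \<alpha>] by (simp add: \<alpha>_def flip: power_mult)
  also have "\<dots> \<le> n * (1 / 2) ^ l + n / 2 ^ l"
  proof (intro add_mono mult_left_mono power_mono)
    have "512 * real \<beta> * 2 ^ l \<le> 512 * (512 * real \<beta> * 2 ^ l)" by simp
    also have "\<dots> \<le> n" using l_small' by simp
    finally show "real (512 * \<beta>) \<le> n / 2 ^ l" by (simp add: field_simps)
  qed (use power_512_bounds in auto)
  finally show ?thesis by (simp add: power_divide)
qed

text \<open>The quotient \<open>b j div 2 ^ l\<close> is the exponent in the tail bound for
  underfull buckets. The 2 in \<open>\<theta> + 2\<close> pays for two roundings, one in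
  \<open>b j\<close> and one in this quotient.\<close>

lemma buckets_div_ge:
  assumes "j < \<alpha>"
  shows "\<theta> \<le> real (b j div 2 ^ l)"
proof -
  have "4 ^ l * ((512 * \<beta> * 2 ^ l) * (\<theta> + 2)) \<le> n"
    using \<theta>_funnel by (simp add: \<beta>_def mult_ac)
  then have "(512 * \<beta> * 2 ^ l) * (\<theta> + 2) \<le> n / 4 ^ l"
    by (simp add: field_simps)
  also have "\<dots> \<le> R j"
    using rest_alpha_ge rest_antimono[of j \<alpha>] assms by linarith
  finally have "(\<theta> + 2) * 2 ^ l \<le> R j / (512 * \<beta>)"
    using beta_pos by (simp add: field_simps)
  also have "\<dots> \<le> real (b j) + 1"
    using nat_div_bounds(2)[of "512 * \<beta>" "R j"] beta_pos by (simp add: b_funnel[OF assms])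
  also have "\<dots> \<le> real (b j) + 2 ^ l" by simp
  finally have "(\<theta> + 2) * 2 ^ l \<le> real (b j) + 2 ^ l" .
  then have "\<theta> + 1 \<le> b j / 2 ^ l"
    by (simp add: field_simps)
  then show ?thesis
    using nat_div_bounds(2)[of "2 ^ l" "b j"] by simp
qed

lemma rest_alpha_overflow: "\<theta> * 2 ^ (2 * h + 2) * sqrt n \<le> R \<alpha>"
proof -
  have "\<theta> * 2 ^ (2 * h + 2) * sqrt n \<le> n / 4 ^ l"
    using \<theta>_overflow by (simp add: field_simps)
  then show ?thesis using rest_alpha_ge by linarith
qed

lemma sqrt_n_ge: "4 \<le> sqrt n"
  using n_ge real_sqrt_le_mono[of 16 n] by simp

lemma overflow_buckets_ge:
  assumes "t < 2 * h"
  shows "R \<alpha> / 2 ^ (t + 2) \<le> b (\<alpha> + t)" "0 < b (\<alpha> + t)"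
proof -
  have "2 ^ (t + 2) \<le> (2 :: real) ^ (2 * h + 2)"
    using assms by (intro power_increasing) auto
  also have "\<dots> \<le> (\<theta> * 2 ^ (2 * h + 2)) * sqrt n"
  proof -
    have "1 * (2 :: real) ^ (2 * h + 2) * 1 \<le> (\<theta> * 2 ^ (2 * h + 2)) * sqrt n"
      using \<theta>_ge sqrt_n_ge n_ge by (intro mult_mono) auto
    then show ?thesis by simp
  qed
  also have "\<dots> \<le> R \<alpha>" by (rule rest_alpha_overflow)
  finally have 1: "1 \<le> R \<alpha> / 2 ^ (t + 2)" by simp
  have "R \<alpha> / 2 ^ (t + 1) < b (\<alpha> + t) + 1"
    using nat_div_bounds(2)[of "2 ^ (t + 1)" "R \<alpha>"] unfolding b_overflow by simp
  moreover have "R \<alpha> / 2 ^ (t + 1) = 2 * (R \<alpha> / 2 ^ (t + 2))" by simp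
  ultimately show "R \<alpha> / 2 ^ (t + 2) \<le> b (\<alpha> + t)" using 1 by linarith
  then show "0 < b (\<alpha> + t)" using 1 by linarith
qed

definition "L = \<alpha> + 2 * h"

lemma split_levels: "j < L \<Longrightarrow> j < \<alpha> \<or> (\<exists>t<2 * h. j = \<alpha> + t)"
  unfolding L_def by (metis add_less_cancel_left le_Suc_ex not_less)

lemma sum_levels: "(\<Sum>j<L. f j) = (\<Sum>j<\<alpha>. f j) + (\<Sum>t<2 * h. f (\<alpha> + t))"
  for f :: "nat \<Rightarrow> 'a :: comm_monoid_add"
proof -
  have "{..<L} = {..<\<alpha>} \<union> {\<alpha>..<\<alpha> + 2 * h}" by (auto simp: L_def)
  then have "(\<Sum>j<L. f j) = (\<Sum>j<\<alpha>. f j) + (\<Sum>j=\<alpha>..<\<alpha> + 2 * h. f j)"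
    by (simp add: sum.union_disjoint ivl_disj_int)
  also have "(\<Sum>j=\<alpha>..<\<alpha> + 2 * h. f j) = (\<Sum>t<2 * h. f (\<alpha> + t))"
    using sum.shift_bounds_nat_ivl[of f 0 \<alpha> "2 * h"] by (simp add: lessThan_atLeast0 add.commute)
  finally show ?thesis .
qed

lemma rest_add_funnel: "(\<Sum>j<k. \<beta> * (R j div (512 * \<beta>))) + R k = n"
proof (induction k)
  case (Suc k)
  then show ?case using rest_add_level[of k] by simp
qed simp

lemma sum_halves_le: "(\<Sum>t<k. N div 2 ^ (t + 1)) \<le> (N :: nat)"
proof -
  have "(\<Sum>t<k. N div 2 ^ (t + 1)) + N div 2 ^ k \<le> N"
  proof (induction k)
    case (Suc k)
    have "N div 2 ^ (k + 1) + N div 2 ^ (k + 1) \<le> N div 2 ^ k"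
      by (simp add: div_mult2_eq mult.commute[of 2])
    then show ?case using Suc by simp
  qed simp
  then show ?thesis by linarith
qed

sublocale bucket_levels n L b w
proof
  show "1 \<le> n" using n_ge by simp
  fix j assume "j < L"
  then show "0 < b j"
  proof (rule split_levels[THEN disjE])
    assume "j < \<alpha>"
    then show ?thesis
      using buckets_div_ge[of j] \<theta>_pos by (cases "b j") auto
  qed (use overflow_buckets_ge in auto)
next
  have "(\<Sum>j<L. b j * w j) = (\<Sum>j<\<alpha>. \<beta> * (R j div (512 * \<beta>))) + (\<Sum>t<2 * h. R \<alpha> div 2 ^ (t + 1))"
    unfolding sum_levels b_overflow w_overflow
    by (intro arg_cong2[where f = "(+)"] sum.cong) (auto simp: b_funnel w_funnel)
  also have "\<dots> \<le> n"
    using rest_add_funnel[of \<alpha>] sum_halves_le[of "R \<alpha>" "2 * h"] by linarith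
  finally show "(\<Sum>j<L. b j * w j) \<le> n" .
qed

text \<open>
  The exponent solves the recursion of the overflow counts, which roughly square relative to the
  level sizes \<open>R \<alpha> / 2\<^bsup>t + 1\<^esup>\<close>; the floor \<open>\<theta>\<close> keeps the counts large enough to concentrate.
\<close>

definition threshold :: "nat \<Rightarrow> real" where
  "threshold t = max (R \<alpha> / 2 ^ (2 ^ t + t + 5)) \<theta>"

lemma threshold_ge: "\<theta> \<le> threshold t" and threshold_nonneg: "0 \<le> threshold t"
  using \<theta>_pos by (auto simp: threshold_def)

lemma theta_fraction_le:
  assumes "t < 2 * h"
  shows "\<theta> * 2 ^ (t + 2) / R \<alpha> \<le> 1 / sqrt n"
proof -
  have R: "0 < real (R \<alpha>)"
  proof -
    have "0 < \<theta> * 2 ^ (2 * h + 2) * sqrt n"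
      using \<theta>_pos n_ge by simp
    then show ?thesis using rest_alpha_overflow by linarith
  qed
  have "\<theta> * 2 ^ (t + 2) * sqrt n \<le> \<theta> * 2 ^ (2 * h + 2) * sqrt n"
    using assms \<theta>_pos by (intro mult_right_mono mult_left_mono power_increasing) auto
  also have "\<dots> \<le> R \<alpha>" by (rule rest_alpha_overflow)
  finally show ?thesis using R n_ge by (simp add: field_simps)
qed

lemma rest_alpha_pos: "0 < real (R \<alpha>)"
  using overflow_buckets_ge[of 0] h_pos by (cases "R \<alpha>") (auto simp: b_overflow[of 0, simplified])

text \<open>Division by the level size, at least \<open>R \<alpha> / 2 ^ (t + 2)\<close>, cancels
  the linear part of the exponent in \<open>threshold\<close> and leaves a doubly exponential load,
  or the share of the floor \<theta>.\<close>

lemma load_le: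
  assumes "t < 2 * h"
  shows "threshold t / b (\<alpha> + t) \<le> max (1 / 2 ^ (2 ^ t + 3)) (1 / sqrt n)"
proof -
  have "threshold t / b (\<alpha> + t) \<le> threshold t / (R \<alpha> / 2 ^ (t + 2))"
    using overflow_buckets_ge[OF assms] rest_alpha_pos threshold_nonneg
    by (intro divide_left_mono) auto
  also have "\<dots> = max (1 / 2 ^ (2 ^ t + 3)) (\<theta> * 2 ^ (t + 2) / R \<alpha>)"
  proof -
    have "threshold t * (2 ^ (t + 2) / R \<alpha>)
       = max (R \<alpha> / 2 ^ (2 ^ t + t + 5) * (2 ^ (t + 2) / R \<alpha>)) (\<theta> * (2 ^ (t + 2) / R \<alpha>))"
      unfolding threshold_def using rest_alpha_pos by (subst max_mult_distrib_right) auto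
    also have "R \<alpha> / 2 ^ (2 ^ t + t + 5) * (2 ^ (t + 2) / R \<alpha>) = 1 / 2 ^ (2 ^ t + 3)"
      using rest_alpha_pos by (simp add: power_add field_simps)
    finally show ?thesis by (simp add: field_simps)
  qed
  also have "\<dots> \<le> max (1 / 2 ^ (2 ^ t + 3)) (1 / sqrt n)"
    using theta_fraction_le[OF assms] by auto
  finally show ?thesis .
qed

lemma load_le_half: "t < 2 * h \<Longrightarrow> threshold t / b (\<alpha> + t) \<le> 1 / 2"
proof -
  assume "t < 2 * h"
  moreover have "1 / 2 ^ (2 ^ t + 3) \<le> (1 / 2 :: real)"
    using power_increasing[of 1 "2 ^ t + 3" "2 :: real"] by (simp add: field_simps)
  moreover have "1 / sqrt n \<le> 1 / 2"
    using sqrt_n_ge n_ge by (simp add: divide_le_eq)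
  ultimately show ?thesis using load_le[of t] by linarith
qed

text \<open>By \<open>h_ge\<close> the doubly exponential part has dropped below
  \<open>1 / sqrt n\<close> after \<open>h\<close> levels, so both parts of the load are that
  small.\<close>

lemma load_le_sqrt:
  assumes "h \<le> t" "t < 2 * h"
  shows "threshold t / b (\<alpha> + t) \<le> 1 / sqrt n"
proof -
  have "sqrt n \<le> n"
    using n_ge sqrt_n_ge mult_left_mono[of 1 "sqrt n" "sqrt n"] by simp
  also have "real n \<le> 2 ^ 2 ^ h"
    using h_ge by (metis of_nat_le_iff of_nat_numeral of_nat_power)
  also have "\<dots> \<le> 2 ^ (2 ^ t + 3)"
  proof (rule power_increasing)
    have "(2 :: nat) ^ h \<le> 2 ^ t" using assms(1) by (intro power_increasing) auto
    then show "(2 :: nat) ^ h \<le> 2 ^ t + 3" by linarith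
  qed simp
  finally have "1 / 2 ^ (2 ^ t + 3) \<le> 1 / sqrt n"
    using n_ge by (intro divide_left_mono) auto
  then show ?thesis using load_le[OF assms(2)] by simp
qed

text \<open>The square over \<open>b\<close> is the exponent in \<open>prob_many_overflow\<close>.
  Kept at a quarter of the next threshold \<open>M'\<close>, it contributes at most
  \<open>2 powr (M' / 2)\<close>, half of what \<open>2 powr M'\<close> gains in the exponent. Above
  the floor the exponents match exactly; at the floor it is enough that the load is at most
  1/4.\<close>

lemma threshold_step:
  assumes "t < 2 * h"
  shows "4 * ((threshold t)\<^sup>2 / b (\<alpha> + t)) \<le> threshold (Suc t)"
proof (cases "\<theta> \<le> R \<alpha> / 2 ^ (2 ^ t + t + 5)")
  case True
  then have M: "threshold t = R \<alpha> / 2 ^ (2 ^ t + t + 5)" by (simp add: threshold_def)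
  have "4 * ((threshold t)\<^sup>2 / b (\<alpha> + t)) \<le> 4 * ((threshold t)\<^sup>2 / (R \<alpha> / 2 ^ (t + 2)))"
    using overflow_buckets_ge[OF assms] rest_alpha_pos
    by (intro mult_left_mono divide_left_mono) auto
  also have "\<dots> = R \<alpha> / 2 ^ (2 ^ Suc t + Suc t + 5)"
  proof -
    have "(2 :: real) ^ (2 ^ Suc t + Suc t + 5) * (4 * 2 ^ (t + 2)) = (2 ^ (2 ^ t + t + 5))\<^sup>2"
      by (simp add: power_add power_even_eq power2_eq_square)
    then show ?thesis
      using rest_alpha_pos unfolding M by (simp add: power_divide field_simps power2_eq_square)
  qed
  also have "\<dots> \<le> threshold (Suc t)" by (simp add: threshold_def)
  finally show ?thesis .
next
  case False
  then have M: "threshold t = \<theta>" by (simp add: threshold_def)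
  have "threshold t / b (\<alpha> + t) \<le> \<theta> / (R \<alpha> / 2 ^ (t + 2))"
    unfolding M using overflow_buckets_ge[OF assms] rest_alpha_pos \<theta>_pos
    by (intro divide_left_mono) auto
  also have "\<dots> \<le> 1 / sqrt n" using theta_fraction_le[OF assms] by simp
  also have "\<dots> \<le> 1 / 4" using sqrt_n_ge n_ge by (simp add: divide_le_eq)
  finally have "(threshold t / b (\<alpha> + t)) * threshold t \<le> 1 / 4 * threshold t"
    using threshold_nonneg by (intro mult_right_mono) auto
  then show ?thesis using threshold_ge[of "Suc t"] M by (simp add: power2_eq_square mult_ac)
qed

end

section \<open>Typical runs of the funnel\<close>

lemma geometric_sum_le:
  fixes x :: real
  assumes "0 \<le> x" "x < 1"
  shows "(\<Sum>t<k. x ^ t) \<le> 1 / (1 - x)"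
proof -
  have "(\<Sum>t<k. x ^ t) = (1 - x ^ k) / (1 - x)"
    using assms by (simp add: sum_gp_strict)
  also have "\<dots> \<le> 1 / (1 - x)"
    using assms by (intro divide_right_mono) auto
  finally show ?thesis .
qed

context funnel begin

definition calm :: "(nat \<Rightarrow> nat \<Rightarrow> nat) \<Rightarrow> nat \<Rightarrow> bool" where
  "calm \<sigma> i \<longleftrightarrow> (\<forall>t<2 * h. real (arrivals \<sigma> i (\<alpha> + t)) \<le> threshold t)"

definition underfilled :: "nat \<Rightarrow> (nat \<Rightarrow> nat \<Rightarrow> nat) set" where
  "underfilled j = {\<sigma>. 4 * b j * w j \<le> arrivals \<sigma> m j \<and>
     b j div 2 ^ l \<le> card {x\<in>{..<b j}. attempts \<sigma> m j x < w j}}"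

definition overflowing :: "nat \<Rightarrow> (nat \<Rightarrow> nat \<Rightarrow> nat) set" where
  "overflowing t = {\<sigma>. real (arrivals \<sigma> m (\<alpha> + t)) \<le> threshold t \<and>
     threshold (Suc t) \<le> real (arrivals \<sigma> m (Suc (\<alpha> + t)))}"

text \<open>Calmness before key \<open>i\<close> is part of the event since it depends on earlier
  keys only; the probability then factorises over the choices of key \<open>i\<close>.\<close>

definition unplaced :: "nat \<Rightarrow> (nat \<Rightarrow> nat \<Rightarrow> nat) set" where
  "unplaced i = {\<sigma>. calm \<sigma> i \<and> arrives \<sigma> i L}"

definition bad :: "(nat \<Rightarrow> nat \<Rightarrow> nat) set" where
  "bad = (\<Union>j<\<alpha>. underfilled j) \<union> (\<Union>t<2 * h. overflowing t) \<union> (\<Union>i<m. unplaced i)"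

definition failure :: real where
  "failure = 3 * \<alpha> / 2 powr \<theta> + 2 * h / 2 powr (\<theta> / 2) + n * (1 / sqrt n) ^ h"

lemma level_less_L: "j < \<alpha> \<Longrightarrow> j < L" "t < 2 * h \<Longrightarrow> \<alpha> + t < L"
  by (simp_all add: L_def)

lemma prob_underfilled:
  assumes "j < \<alpha>"
  shows "measure_pmf.prob (runs m) (underfilled j) \<le> 3 / 2 powr \<theta>"
proof -
  have "measure_pmf.prob (runs m) (underfilled j) \<le> 3 / 2 ^ (b j div 2 ^ l)"
    unfolding underfilled_def
    using assms by (intro prob_many_underfull_fraction level_less_L) (auto simp: w_funnel \<beta>_def power_add)
  also have "\<dots> = 3 / 2 powr real (b j div 2 ^ l)"
    by (simp add: powr_realpow)
  also have "\<dots> \<le> 3 / 2 powr \<theta>"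
    using buckets_div_ge[OF assms] by (intro divide_left_mono powr_mono) auto
  finally show ?thesis .
qed

lemma prob_overflowing:
  assumes "t < 2 * h"
  shows "measure_pmf.prob (runs m) (overflowing t) \<le> 1 / 2 powr (\<theta> / 2)"
proof -
  let ?M = "threshold t" and ?M' = "threshold (Suc t)"
  have "measure_pmf.prob (runs m) (overflowing t) \<le> exp (?M\<^sup>2 / b (\<alpha> + t)) / 2 powr ?M'"
    unfolding overflowing_def using assms threshold_nonneg
    by (intro prob_many_overflow level_less_L) (auto simp: w_overflow)
  also have "exp (?M\<^sup>2 / b (\<alpha> + t)) \<le> 4 powr (?M\<^sup>2 / b (\<alpha> + t))"
  proof -
    have "exp (?M\<^sup>2 / b (\<alpha> + t)) = exp 1 powr (?M\<^sup>2 / b (\<alpha> + t))"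
      by (simp add: powr_def)
    also have "\<dots> \<le> 4 powr (?M\<^sup>2 / b (\<alpha> + t))"
      using exp_le by (intro powr_mono2) auto
    finally show ?thesis .
  qed
  also have "\<dots> = 2 powr (2 * (?M\<^sup>2 / b (\<alpha> + t)))"
    using powr_powr[of 2 2 "?M\<^sup>2 / b (\<alpha> + t)"] by simp
  also have "\<dots> \<le> 2 powr (?M' / 2)"
    using threshold_step[OF assms] by (intro powr_mono) auto
  also have "2 powr (?M' / 2) / 2 powr ?M' = 1 / 2 powr (?M' / 2)"
    by (simp add: powr_diff[symmetric] powr_minus_divide[symmetric])
  also have "\<dots> \<le> 1 / 2 powr (\<theta> / 2)"
    using threshold_ge[of "Suc t"] by (intro divide_left_mono powr_mono) auto
  finally show ?thesis by (simp add: divide_right_mono)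
qed

lemma calm_upd: "calm (\<sigma>(i := s)) i = calm \<sigma> i"
proof -
  have "arrivals (\<sigma>(i := s)) i = arrivals \<sigma> i" by (rule arrivals_cong) simp
  then show ?thesis by (simp add: calm_def)
qed

lemma calm_full_le:
  assumes "\<And>k. k < i \<Longrightarrow> valid (\<sigma> k)" "calm \<sigma> i" "\<alpha> \<le> j" "j < L"
  shows "real (card {x\<in>{..<b j}. w j \<le> attempts \<sigma> i j x}) \<le> threshold (j - \<alpha>) / b j * b j"
proof -
  obtain t where t: "t < 2 * h" "j = \<alpha> + t"
    using split_levels[OF assms(4)] assms(3) by auto
  have "card {x\<in>{..<b j}. w j \<le> attempts \<sigma> i j x} \<le> arrivals \<sigma> i j"
    using assms t by (intro card_full_le_arrivals) (auto simp: w_overflow)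
  also have "real (arrivals \<sigma> i j) \<le> threshold t"
    using assms(2) t by (auto simp: calm_def)
  also have "\<dots> = threshold (j - \<alpha>) / b j * b j"
    using overflow_buckets_ge(2)[OF t(1)] t by simp
  finally show ?thesis by simp
qed

lemma prob_calm_arrives:
  assumes "i < m" "s \<le> t" "t \<le> 2 * h"
  shows "measure_pmf.prob (runs m) {\<sigma>. calm \<sigma> i \<and> arrives \<sigma> i (\<alpha> + t)}
    \<le> (\<Prod>u=s..<t. threshold u / b (\<alpha> + u))"
proof -
  have "measure_pmf.prob (runs m) {\<sigma>. calm \<sigma> i \<and> arrives \<sigma> i (\<alpha> + t)}
    \<le> (\<Prod>j=\<alpha>+s..<\<alpha>+t. threshold (j - \<alpha>) / b j)"
    using assms threshold_nonneg
    by (intro prob_arrives_le calm_full_le calm_upd) (auto simp: L_def)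
  also have "\<dots> = (\<Prod>u=s..<t. threshold u / b (\<alpha> + u))"
    using prod.shift_bounds_nat_ivl[of "\<lambda>j. threshold (j - \<alpha>) / b j" s \<alpha> t] by (simp add: add.commute)
  finally show ?thesis .
qed

text \<open>Only the second half of the overflow levels is used; the first half serves to bring the
  load down.\<close>

lemma prob_unplaced:
  assumes "i < m"
  shows "measure_pmf.prob (runs m) (unplaced i) \<le> (1 / sqrt n) ^ h"
proof -
  have "measure_pmf.prob (runs m) (unplaced i) \<le> (\<Prod>u=h..<2 * h. threshold u / b (\<alpha> + u))"
    using prob_calm_arrives[of i h "2 * h"] assms by (simp add: unplaced_def L_def[symmetric])
  also have "\<dots> \<le> (\<Prod>u=h..<2 * h. 1 / sqrt n)"
    using load_le_sqrt threshold_nonneg by (intro prod_mono) auto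
  also have "\<dots> = (1 / sqrt n) ^ h" by simp
  finally show ?thesis .
qed

lemma prob_bad: "measure_pmf.prob (runs m) bad \<le> failure"
proof -
  let ?P = "measure_pmf.prob (runs m)"
  have 1: "?P (\<Union>j<\<alpha>. underfilled j) \<le> 3 * \<alpha> / 2 powr \<theta>"
  proof -
    have "?P (\<Union>j<\<alpha>. underfilled j) \<le> (\<Sum>j<\<alpha>. ?P (underfilled j))"
      by (intro measure_UNION_le) auto
    also have "\<dots> \<le> (\<Sum>j<\<alpha>. 3 / 2 powr \<theta>)"
      by (intro sum_mono prob_underfilled) auto
    finally show ?thesis by (simp add: mult.commute)
  qed
  have 2: "?P (\<Union>t<2 * h. overflowing t) \<le> 2 * h / 2 powr (\<theta> / 2)"
  proof -
    have "?P (\<Union>t<2 * h. overflowing t) \<le> (\<Sum>t<2 * h. ?P (overflowing t))"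
      by (intro measure_UNION_le) auto
    also have "\<dots> \<le> (\<Sum>t<2 * h. 1 / 2 powr (\<theta> / 2))"
      by (intro sum_mono prob_overflowing) auto
    finally show ?thesis by simp
  qed
  have 3: "?P (\<Union>i<m. unplaced i) \<le> n * (1 / sqrt n) ^ h"
  proof -
    have "?P (\<Union>i<m. unplaced i) \<le> (\<Sum>i<m. ?P (unplaced i))"
      by (intro measure_UNION_le) auto
    also have "\<dots> \<le> (\<Sum>i<m. (1 / sqrt n) ^ h)"
      by (intro sum_mono prob_unplaced) auto
    also have "\<dots> = m * (1 / sqrt n) ^ h" by simp
    also have "\<dots> \<le> n * (1 / sqrt n) ^ h"
      using m_le by (intro mult_right_mono) auto
    finally show ?thesis .
  qed
  have "?P bad \<le> ?P (\<Union>j<\<alpha>. underfilled j) + ?P (\<Union>t<2 * h. overflowing t) + ?P (\<Union>i<m. unplaced i)"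
    unfolding bad_def by (intro order_trans[OF measure_Un_le] add_mono measure_Un_le) auto
  then show ?thesis using 1 2 3 unfolding failure_def by linarith
qed

text \<open>
  The first alternative: all earlier levels were filled except for a fraction \<open>2\<^bsup>-l\<^esup>\<close>.  The second:
  some earlier level received few attempts.
\<close>

lemma funnel_arrivals_le:
  assumes v: "\<And>k. valid (\<sigma> k)" and good: "\<sigma> \<notin> bad" and "j \<le> \<alpha>"
  shows "real (arrivals \<sigma> m j) \<le> real (R j) - D + (real n - R j) / 2 ^ l \<or> real (arrivals \<sigma> m j) \<le> R j / 64"
  using \<open>j \<le> \<alpha>\<close>
proof (induction j)
  case 0
  have "real (m + D) \<le> real n" using m_le by (rule of_nat_mono)
  then show ?case by simp
next
  case (Suc j)
  define a where "a = \<beta> * real (b j)"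
  have j: "j < \<alpha>" using Suc by simp
  have b: "b j = R j div (512 * \<beta>)" using b_funnel[OF j] .
  have R: "real (R (Suc j)) = R j - a"
    using rest_add_level[of j] unfolding a_def b by (metis add_diff_cancel_right' of_nat_add of_nat_mult)
  have a: "512 * a \<le> R j" "0 \<le> a"
    using of_nat_mono[OF level_le_rest[of j], where 'a = real] by (simp_all add: a_def b)
  have two: "2 \<le> (2 :: real) ^ l"
    using power_increasing[of 1 l "2 :: real"] l_pos by simp
  show ?case
  proof (cases "4 * b j * w j \<le> arrivals \<sigma> m j")
    \<comment> \<open>Here \<open>4 * a \<le> R j / 128\<close>, and \<open>R (Suc j)\<close> is
      nearly \<open>R j\<close>: the second alternative starts at such a level.\<close>
    case False
    then have "real (arrivals \<sigma> m j) < real (4 * b j * w j)"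
      by (simp only: of_nat_less_iff not_le)
    then have "real (arrivals \<sigma> m j) < 4 * a"
      by (simp add: a_def w_funnel[OF j] mult_ac)
    moreover have "real (arrivals \<sigma> m (Suc j)) \<le> arrivals \<sigma> m j"
      using arrivals_level_antimono[of j "Suc j" \<sigma> m] by simp
    ultimately show ?thesis using a R by linarith
  next
    case True
    let ?U = "{x\<in>{..<b j}. attempts \<sigma> m j x < w j}"
    have "\<sigma> \<notin> underfilled j" using good j by (auto simp: bad_def)
    then have U: "card ?U \<le> b j div 2 ^ l" using True by (auto simp: underfilled_def)
    then have "real (card ?U) \<le> real (b j div 2 ^ l)" by simp
    also have "\<dots> \<le> b j / 2 ^ l" using nat_div_bounds(1)[of "2 ^ l" "b j"] by simp
    finally have U': "\<beta> * real (card ?U) \<le> a / 2 ^ l"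
      unfolding a_def by (simp add: mult_left_mono flip: times_divide_eq_right)
    have "a - \<beta> * real (card ?U) = (\<Sum>x<b j. real \<beta> - real \<beta> * of_bool (attempts \<sigma> m j x < w j))"
      by (simp add: sum_subtractf a_def Int_def conj_commute flip: sum_distrib_left)
    also have "\<dots> \<le> (\<Sum>x<b j. real (min (w j) (attempts \<sigma> m j x)))"
      by (intro sum_mono) (auto simp: w_funnel[OF j])
    finally have "a - a / 2 ^ l \<le> real (\<Sum>x<b j. min (w j) (attempts \<sigma> m j x))"
      using U' by simp
    moreover have "real (arrivals \<sigma> m (Suc j)) + real (\<Sum>x<b j. min (w j) (attempts \<sigma> m j x)) = arrivals \<sigma> m j"
      using arrivals_Suc_level[of m \<sigma> j] v level_less_L(1)[OF j] by (metis of_nat_add)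
    ultimately have Y: "real (arrivals \<sigma> m (Suc j)) \<le> arrivals \<sigma> m j - a + a / 2 ^ l"
      by linarith
    have "real (arrivals \<sigma> m j) \<le> real (R j) - D + (real n - R j) / 2 ^ l \<or> real (arrivals \<sigma> m j) \<le> R j / 64"
      using Suc by simp
    then show ?thesis
    proof
      \<comment> \<open>The new holes, at most \<open>a / 2 ^ l\<close>, are exactly the growth of
        \<open>(n - R j) / 2 ^ l\<close>.\<close>
      assume "real (arrivals \<sigma> m j) \<le> real (R j) - D + (real n - R j) / 2 ^ l"
      moreover have "(real n - R (Suc j)) / 2 ^ l = (real n - R j) / 2 ^ l + a / 2 ^ l"
        unfolding R by (simp add: add_divide_distrib[symmetric])
      ultimately show ?thesis using Y R by linarith
    next
      \<comment> \<open>The arrivals drop by at least \<open>a / 2\<close>, whereas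
        \<open>R j / 64\<close> drops only by \<open>a / 64\<close>.\<close>
      assume 1: "real (arrivals \<sigma> m j) \<le> R j / 64"
      have "a / 2 ^ l \<le> a / 2"
        using two a by (intro divide_left_mono) auto
      then have "real (arrivals \<sigma> m (Suc j)) \<le> R (Suc j) / 64"
        using 1 Y R a by linarith
      then show ?thesis ..
    qed
  qed
qed

lemma D_ge_real: "3 * n / 2 ^ l \<le> D"
proof -
  have "real (3 * n) \<le> real (D * 2 ^ l)" using D_ge by (rule of_nat_mono)
  then show ?thesis by (simp add: field_simps)
qed

lemma funnel_arrivals_le_rest:
  assumes "\<And>k. valid (\<sigma> k)" "\<sigma> \<notin> bad" "j \<le> \<alpha>"
  shows "real (arrivals \<sigma> m j) \<le> R j"
proof -
  have "(real n - R j) / 2 ^ l \<le> 3 * n / 2 ^ l"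
    by (intro divide_right_mono) auto
  also have "\<dots> \<le> D" by (rule D_ge_real)
  finally show ?thesis using funnel_arrivals_le[OF assms] by auto
qed

text \<open>At the end of the funnel the first alternative bounds the arrivals by a number that is
  at most 0, because \<open>D\<close> covers both the remainder and the holes.\<close>

lemma funnel_overflow_le:
  assumes "\<And>k. valid (\<sigma> k)" "\<sigma> \<notin> bad"
  shows "real (arrivals \<sigma> m \<alpha>) \<le> R \<alpha> / 64"
proof -
  have "(real n - R \<alpha>) / 2 ^ l \<le> n / 2 ^ l"
    by (intro divide_right_mono) auto
  moreover have "2 * n / 2 ^ l + n / 2 ^ l = 3 * n / 2 ^ l"
    by (simp add: add_divide_distrib[symmetric])
  ultimately have "real (R \<alpha>) - D + (real n - R \<alpha>) / 2 ^ l \<le> 0"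
    using rest_alpha_le D_ge_real by linarith
  then show ?thesis using funnel_arrivals_le[OF assms, of \<alpha>] by auto
qed

text \<open>The funnel delivers at most \<open>R \<alpha> / 64\<close> keys, which is the first part
  of \<open>threshold 0\<close> as 2 ^ 0 + 0 + 5 = 6; after that, the absence of
  \<open>overflowing\<close> events passes the bound from level to level.\<close>

lemma calm_if_good:
  assumes "\<And>k. valid (\<sigma> k)" "\<sigma> \<notin> bad"
  shows "calm \<sigma> m"
proof -
  have "real (arrivals \<sigma> m (\<alpha> + t)) \<le> threshold t" if "t < 2 * h" for t
    using that
  proof (induction t)
    case 0
    then show ?case using funnel_overflow_le[OF assms] by (simp add: threshold_def)
  next
    case (Suc t)
    then show ?case using assms(2) by (force simp: bad_def overflowing_def)
  qed
  then show ?thesis by (simp add: calm_def)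
qed

lemma calm_antimono:
  assumes "calm \<sigma> m" "i \<le> m"
  shows "calm \<sigma> i"
  unfolding calm_def
proof (intro allI impI)
  fix t assume "t < 2 * h"
  then have "real (arrivals \<sigma> m (\<alpha> + t)) \<le> threshold t"
    using assms(1) by (simp add: calm_def)
  then show "real (arrivals \<sigma> i (\<alpha> + t)) \<le> threshold t"
    using arrivals_mono[OF assms(2), of \<sigma> "\<alpha> + t"] by linarith
qed

lemma not_arrives_if_good:
  assumes "\<And>k. valid (\<sigma> k)" "\<sigma> \<notin> bad" "i < m"
  shows "\<not> arrives \<sigma> i L"
  using assms calm_antimono[OF calm_if_good[OF assms(1,2)], of i]
  by (auto simp: bad_def unplaced_def)

text \<open>Calmness is built in so that the expectation can be bounded over all runs; in a run
  outside \<open>bad\<close> it holds automatically.\<close>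

definition overflow_levels :: "(nat \<Rightarrow> nat \<Rightarrow> nat) \<Rightarrow> nat \<Rightarrow> nat" where
  "overflow_levels \<sigma> i = (\<Sum>t<2 * h. of_bool (calm \<sigma> i \<and> arrives \<sigma> i (\<alpha> + t)))"

text \<open>Loads of at most 1/2 make the probability of reaching overflow level \<open>t\<close> at
  most \<open>(1 / 2) ^ t\<close>. Hence the \<open>2 * h\<close> levels add only a constant to an
  expected cost, and \<open>log log n\<close> appears in the maximum alone.\<close>

lemma nn_integral_overflow_levels:
  assumes "i < m"
  shows "(\<integral>\<^sup>+\<sigma>. of_nat (overflow_levels \<sigma> i) \<partial>runs m) \<le> 2"
proof -
  have "(\<integral>\<^sup>+\<sigma>. of_nat (overflow_levels \<sigma> i) \<partial>runs m)
      = (\<integral>\<^sup>+\<sigma>. (\<Sum>t<2 * h. indicator {\<sigma>. calm \<sigma> i \<and> arrives \<sigma> i (\<alpha> + t)} \<sigma>) \<partial>runs m)"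
    by (intro nn_integral_cong) (auto simp: overflow_levels_def of_bool_def indicator_def intro!: sum.cong)
  also have "\<dots> = (\<Sum>t<2 * h. emeasure (runs m) {\<sigma>. calm \<sigma> i \<and> arrives \<sigma> i (\<alpha> + t)})"
    by (subst nn_integral_sum) auto
  also have "\<dots> \<le> (\<Sum>t<2 * h. ennreal ((1 / 2) ^ t))"
  proof (intro sum_mono)
    fix t assume "t \<in> {..<2 * h}"
    then have t: "t < 2 * h" by simp
    have "measure_pmf.prob (runs m) {\<sigma>. calm \<sigma> i \<and> arrives \<sigma> i (\<alpha> + t)}
       \<le> (\<Prod>u=0..<t. threshold u / b (\<alpha> + u))"
      using assms t by (intro prob_calm_arrives) auto
    also have "\<dots> \<le> (\<Prod>u=0..<t. 1 / 2)"
      using load_le_half t threshold_nonneg by (intro prod_mono) auto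
    finally show "emeasure (runs m) {\<sigma>. calm \<sigma> i \<and> arrives \<sigma> i (\<alpha> + t)} \<le> ennreal ((1 / 2) ^ t)"
      by (simp add: measure_pmf.emeasure_eq_measure ennreal_leI)
  qed
  also have "\<dots> = ennreal (\<Sum>t<2 * h. (1 / 2) ^ t)"
    by (intro sum_ennreal) auto
  also have "\<dots> \<le> ennreal 2"
    using geometric_sum_le[of "1 / 2" "2 * h"] by (intro ennreal_leI) simp
  finally show ?thesis by simp
qed

lemma sum_width: "(\<Sum>j<L. w j) = \<alpha> * \<beta> + 2 * h"
  by (simp add: sum_levels w_funnel w_overflow)

lemma probe_complexity_if_good:
  assumes "\<And>k. valid (\<sigma> k)" "\<sigma> \<notin> bad" "i < m" "\<And>k. k < m \<Longrightarrow> H k = sequence (\<sigma> k)"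
  shows "probe_complexity H i \<le> of_nat (\<Sum>j<L. w j * of_bool (arrives \<sigma> i j))"
  using assms by (intro probe_complexity_le_arrives not_arrives_if_good) auto

lemma max_probe_complexity_if_good:
  assumes "\<And>k. valid (\<sigma> k)" "\<sigma> \<notin> bad" "\<And>k. k < m \<Longrightarrow> H k = sequence (\<sigma> k)"
  shows "max_probe_complexity H m \<le> of_nat (\<alpha> * \<beta> + 2 * h)"
  unfolding max_probe_complexity_def
proof (rule SUP_least)
  fix i assume "i \<in> {..<m}"
  then have "probe_complexity H i \<le> of_nat (\<Sum>j<L. w j * of_bool (arrives \<sigma> i j))"
    using assms by (intro probe_complexity_if_good) auto
  also have "(\<Sum>j<L. w j * of_bool (arrives \<sigma> i j)) \<le> (\<Sum>j<L. w j)"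
    by (intro sum_mono) auto
  also have "\<dots> = \<alpha> * \<beta> + 2 * h" by (rule sum_width)
  finally show "probe_complexity H i \<le> of_nat (\<alpha> * \<beta> + 2 * h)"
    by simp
qed

lemma probe_complexity_bound:
  assumes v: "\<And>k. valid (\<sigma> k)" and i: "i < m" and H: "\<And>k. k < m \<Longrightarrow> H k = sequence (\<sigma> k)"
  shows "probe_complexity H i \<le> of_nat (\<alpha> * \<beta>) + of_nat (overflow_levels \<sigma> i)
           + of_nat (\<alpha> * \<beta> + 2 * h + n) * indicator bad \<sigma>"
proof (cases "\<sigma> \<in> bad")
  case True
  have "probe_complexity H i \<le> of_nat (\<alpha> * \<beta> + 2 * h + n)"
    using probe_complexity_le(2)[of "\<sigma> i" H i] v i H m_le by (simp add: sum_width)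
  also have "\<dots> = of_nat (\<alpha> * \<beta> + 2 * h + n) * indicator bad \<sigma>"
    using True by simp
  finally show ?thesis by (rule order_trans) simp
next
  case False
  have "calm \<sigma> i"
    using calm_antimono[OF calm_if_good[OF v False], of i] i by simp
  have "probe_complexity H i \<le> of_nat (\<Sum>j<L. w j * of_bool (arrives \<sigma> i j))"
    by (rule probe_complexity_if_good[OF v False i H])
  also have "(\<Sum>j<L. w j * of_bool (arrives \<sigma> i j)) \<le> \<alpha> * \<beta> + overflow_levels \<sigma> i"
  proof -
    have "(\<Sum>j<\<alpha>. w j * of_bool (arrives \<sigma> i j)) \<le> (\<Sum>j<\<alpha>. \<beta>)"
      by (intro sum_mono) (auto simp: w_funnel)
    then show ?thesis
      unfolding sum_levels overflow_levels_def using \<open>calm \<sigma> i\<close> by (simp add: w_overflow)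
  qed
  finally show ?thesis using False by simp
qed

text \<open>A geometric series with sum 512, plus \<open>\<alpha>\<close> rounding terms
  \<open>512 * \<beta>\<close> that \<open>l_small\<close> bounds by \<open>n\<close> in
  total.\<close>

lemma sum_rest_le: "(\<Sum>j<\<alpha>. real (R j)) \<le> 513 * n"
proof -
  have "(\<Sum>j<\<alpha>. real (R j)) \<le> (\<Sum>j<\<alpha>. n * (511 / 512) ^ j + 512 * \<beta>)"
    using rest_le by (intro sum_mono) auto
  also have "\<dots> = n * (\<Sum>j<\<alpha>. (511 / 512) ^ j) + 512 * 512 * \<beta> * l"
    by (simp add: sum.distrib sum_distrib_left \<alpha>_def)
  also have "\<dots> \<le> real n * 512 + real n"
  proof (intro add_mono mult_left_mono)
    show "(\<Sum>j<\<alpha>. (511 / 512 :: real) ^ j) \<le> 512"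
      using geometric_sum_le[of "511 / 512" \<alpha>] by simp
    have "real l \<le> 2 ^ l" using of_nat_less_two_power[of l, where 'a = real] by simp
    then have "512 * 512 * real \<beta> * l \<le> 512 * 512 * real \<beta> * 2 ^ l"
      by (intro mult_left_mono) auto
    then show "real (512 * 512 * \<beta> * l) \<le> n" using l_small' by simp
  qed auto
  finally show ?thesis by simp
qed

lemma threshold_le: "t < 2 * h \<Longrightarrow> threshold t \<le> R \<alpha> * (1 / 2) ^ t"
proof -
  assume "t < 2 * h"
  then have "\<theta> * 2 ^ (t + 2) * 1 \<le> \<theta> * 2 ^ (2 * h + 2) * sqrt n"
    using \<theta>_pos sqrt_n_ge n_ge by (intro mult_mono power_increasing) auto
  also have "\<dots> \<le> R \<alpha>" by (rule rest_alpha_overflow)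
  finally have "\<theta> * 2 ^ t * 4 \<le> R \<alpha>" by simp
  then have "\<theta> * 2 ^ t \<le> R \<alpha>" using rest_alpha_pos by linarith
  then have "\<theta> \<le> R \<alpha> / 2 ^ t" by (simp add: field_simps)
  moreover have "R \<alpha> / 2 ^ (2 ^ t + t + 5) \<le> R \<alpha> / 2 ^ t"
    by (intro divide_left_mono power_increasing) auto
  ultimately show ?thesis by (simp add: threshold_def power_divide)
qed

text \<open>Exchanging the sums turns the total cost into widths times arrivals. The arrivals over
  all funnel levels are linear in \<open>n\<close>, so only one factor \<open>\<beta>\<close>
  remains.\<close>

lemma total_if_good:
  assumes v: "\<And>k. valid (\<sigma> k)" and good: "\<sigma> \<notin> bad" and H: "\<And>k. k < m \<Longrightarrow> H k = sequence (\<sigma> k)"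
  shows "(\<Sum>i<m. probe_complexity H i) \<le> of_nat (515 * \<beta> * n)"
proof -
  have "(\<Sum>i<m. probe_complexity H i) \<le> (\<Sum>i<m. of_nat (\<Sum>j<L. w j * of_bool (arrives \<sigma> i j)))"
    using assms by (intro sum_mono probe_complexity_if_good) auto
  also have "\<dots> = of_nat (\<Sum>i<m. \<Sum>j<L. w j * of_bool (arrives \<sigma> i j))"
    by simp
  also have "(\<Sum>i<m. \<Sum>j<L. w j * of_bool (arrives \<sigma> i j)) = (\<Sum>j<L. w j * arrivals \<sigma> m j)"
    by (subst sum.swap) (simp only: arrivals_def sum_distrib_left)
  also have "\<dots> \<le> 515 * \<beta> * n"
  proof -
    have "real (\<Sum>j<L. w j * arrivals \<sigma> m j)
        = (\<Sum>j<\<alpha>. \<beta> * real (arrivals \<sigma> m j)) + (\<Sum>t<2 * h. real (arrivals \<sigma> m (\<alpha> + t)))"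
      unfolding sum_levels by (simp add: w_funnel w_overflow)
    also have "\<dots> \<le> (\<Sum>j<\<alpha>. \<beta> * real (R j)) + (\<Sum>t<2 * h. R \<alpha> * (1 / 2) ^ t)"
    proof (intro add_mono sum_mono mult_left_mono)
      fix t assume "t \<in> {..<2 * h}"
      then show "real (arrivals \<sigma> m (\<alpha> + t)) \<le> R \<alpha> * (1 / 2) ^ t"
        using calm_if_good[OF v good] threshold_le[of t] by (force simp: calm_def)
    qed (use funnel_arrivals_le_rest[OF v good] in auto)
    also have "\<dots> = \<beta> * (\<Sum>j<\<alpha>. real (R j)) + R \<alpha> * (\<Sum>t<2 * h. (1 / 2) ^ t)"
      by (simp add: sum_distrib_left)
    also have "\<dots> \<le> real \<beta> * (513 * real n) + real n * 2"
    proof (intro add_mono mult_mono)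
      show "(\<Sum>t<2 * h. (1 / 2 :: real) ^ t) \<le> 2"
        using geometric_sum_le[of "1 / 2" "2 * h"] by simp
      show "real (R \<alpha>) \<le> n" using rest_antimono[of 0 \<alpha>] by simp
    qed (use sum_rest_le in \<open>auto intro: sum_nonneg\<close>)
    also have "\<dots> \<le> real \<beta> * (513 * real n) + real \<beta> * (real n * 2)"
      using mult_right_mono[of 1 "real \<beta>" "real n * 2"] beta_pos by simp
    also have "\<dots> = real (515 * \<beta> * n)" by simp
    finally show ?thesis by (simp only: of_nat_le_iff)
  qed
  finally show ?thesis by (simp only: of_nat_le_iff)
qed

end

section \<open>From seeds to probe sequences\<close>

lemma insertion_time_eq: "insertion_time H i = probe_complexity H i"
proof (cases "has_free_slot (occupied H i) (H i)")
  case True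
  let ?f = "first_free (occupied H i) (H i)"
  have free: "H i ?f \<notin> occupied H i"
    using True unfolding has_free_slot_def first_free_def by (metis LeastI)
  have "{k. \<forall>j<k. H i j \<in> occupied H i} = {..?f}"
  proof (intro equalityI subsetI CollectI allI impI)
    fix k assume "k \<in> {k. \<forall>j<k. H i j \<in> occupied H i}"
    then have "\<not> ?f < k" using free by blast
    then show "k \<in> {..?f}" by simp
  next
    fix k j assume "k \<in> {..?f}" "j < k"
    then have "j < ?f" by simp
    then show "H i j \<in> occupied H i"
      unfolding first_free_def by (blast dest: not_less_Least)
  qed
  then show ?thesis
    using True by (simp add: insertion_time_def probe_complexity_def)
next
  case False
  then have "{k. \<forall>j<k. H i j \<in> occupied H i} = UNIV"
    by (auto simp: has_free_slot_def)
  then show ?thesis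
    using False by (simp add: insertion_time_def probe_complexity_def)
qed

section \<open>Measurability of the insertion process\<close>

context
  fixes n m :: nat and S K
  defines "S \<equiv> PiM (UNIV :: nat set) (\<lambda>_. count_space {1..n})"
  defines "K \<equiv> PiM {..<m} (\<lambda>_. S)"
begin

lemma measurable_probe: "i < m \<Longrightarrow> (\<lambda>H. H i k) \<in> K \<rightarrow>\<^sub>M count_space {1..n}"
  unfolding K_def S_def
  using measurable_compose[OF measurable_component_singleton[of i "{..<m}" "\<lambda>_. PiM UNIV (\<lambda>_. count_space {1..n})"]
    measurable_component_singleton[of k UNIV "\<lambda>_. count_space {1..n}"]] by simp

lemma measurable_probe_UNIV: "i < m \<Longrightarrow> (\<lambda>H. H i k) \<in> K \<rightarrow>\<^sub>M count_space UNIV"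
  by (rule measurable_compose[OF measurable_probe]) auto

lemma measurable_has_free_slot:
  assumes "i < m"
  shows "Measurable.pred K (\<lambda>H. has_free_slot occ (H i))"
proof -
  note [measurable] = measurable_probe_UNIV[OF assms]
  show ?thesis unfolding has_free_slot_def by measurable
qed

lemma measurable_first_free:
  assumes "i < m"
  shows "(\<lambda>H. first_free occ (H i)) \<in> K \<rightarrow>\<^sub>M count_space UNIV"
proof -
  note [measurable] = measurable_probe_UNIV[OF assms]
  show ?thesis unfolding first_free_def by measurable
qed

text \<open>The occupied set ranges over the finite set \<open>Pow {1..n}\<close>, so whatever
  depends on it can be checked for one fixed set at a time. This is why the target is not
  \<open>count_space UNIV\<close>.\<close>

lemma measurable_occupied:
  "i \<le> m \<Longrightarrow> (\<lambda>H. occupied H i) \<in> K \<rightarrow>\<^sub>M count_space (Pow {1..n})"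
proof (induction i)
  case (Suc i)
  then have i: "i < m" and IH: "(\<lambda>H. occupied H i) \<in> K \<rightarrow>\<^sub>M count_space (Pow {1..n})"
    by auto
  let ?f = "\<lambda>occ H. if has_free_slot occ (H i) then insert (H i (first_free occ (H i))) occ else occ"
  have "(\<lambda>H. ?f (occupied H i) H) \<in> K \<rightarrow>\<^sub>M count_space (Pow {1..n})"
  proof (rule measurable_compose_countable'[OF _ IH])
    fix occ assume occ: "occ \<in> Pow {1..n}"
    have "(\<lambda>H. H i (first_free occ (H i))) \<in> K \<rightarrow>\<^sub>M count_space {1..n}"
      by (rule measurable_compose_countable'[OF measurable_probe[OF i] measurable_first_free[OF i]]) auto
    then have "(\<lambda>H. insert (H i (first_free occ (H i))) occ) \<in> K \<rightarrow>\<^sub>M count_space (Pow {1..n})"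
      by (rule measurable_compose[where g = "\<lambda>x. insert x occ"]) (use occ in auto)
    then show "?f occ \<in> K \<rightarrow>\<^sub>M count_space (Pow {1..n})"
      using measurable_has_free_slot[OF i] occ by (intro measurable_If) auto
  qed (auto intro: countable_finite)
  then show ?case by (simp cong: if_cong)
qed simp

lemma measurable_has_free_slot_occupied:
  assumes "i < m"
  shows "Measurable.pred K (\<lambda>H. has_free_slot (occupied H i) (H i))"
  by (rule measurable_compose_countable'[OF measurable_has_free_slot[OF assms] measurable_occupied])
    (use assms in \<open>auto intro: countable_finite\<close>)

lemma measurable_probe_complexity:
  assumes "i < m"
  shows "(\<lambda>H. probe_complexity H i) \<in> borel_measurable K"
proof -
  let ?f = "\<lambda>occ H. if has_free_slot occ (H i) then of_nat (Suc (first_free occ (H i))) else \<infinity> :: ennreal"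
  have "(\<lambda>H. ?f (occupied H i) H) \<in> borel_measurable K"
  proof (rule measurable_compose_countable'[OF _ measurable_occupied])
    fix occ
    have "(\<lambda>H. of_nat (Suc (first_free occ (H i))) :: ennreal) \<in> borel_measurable K"
      by (rule measurable_compose[OF measurable_first_free[OF assms]]) simp
    then show "?f occ \<in> borel_measurable K"
      using measurable_has_free_slot[OF assms] by (intro measurable_If) auto
  qed (use assms in \<open>auto intro: countable_finite\<close>)
  then show ?thesis unfolding probe_complexity_def .
qed

end

context bucket_levels begin

definition scheme :: "probe_seq measure" where
  "scheme = distr (measure_pmf seed) (\<Pi>\<^sub>M k\<in>(UNIV :: nat set). count_space {1..n}) sequence"

definition run_probes :: "nat \<Rightarrow> (nat \<Rightarrow> nat \<Rightarrow> nat) \<Rightarrow> nat \<Rightarrow> probe_seq" where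
  "run_probes m \<sigma> = (\<lambda>i\<in>{..<m}. sequence (\<sigma> i))"

lemma sequence_measurable:
  "sequence \<in> measure_pmf seed \<rightarrow>\<^sub>M (\<Pi>\<^sub>M k\<in>(UNIV :: nat set). count_space {1..n})"
  using sequence_range by (auto simp: space_PiM)

lemma probe_distribution_scheme: "probe_distribution n scheme"
  unfolding probe_distribution_def scheme_def
  using measure_pmf.prob_space_distr[OF sequence_measurable] by simp

lemma keys_scheme:
  "keys scheme m = distr (measure_pmf (runs m))
     (PiM {..<m} (\<lambda>_. \<Pi>\<^sub>M k\<in>(UNIV :: nat set). count_space {1..n})) (run_probes m)"
  unfolding keys_def scheme_def runs_def run_probes_def
  by (rule PiM_distr_pmf[OF sequence_measurable]) simp

lemma run_probes_measurable:
  "run_probes m \<in> measure_pmf (runs m) \<rightarrow>\<^sub>M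
     PiM {..<m} (\<lambda>_. \<Pi>\<^sub>M k\<in>(UNIV :: nat set). count_space {1..n})"
  using sequence_range by (auto simp: space_PiM run_probes_def)

lemma run_probes_apply: "i < m \<Longrightarrow> run_probes m \<sigma> i = sequence (\<sigma> i)"
  by (simp add: run_probes_def)

lemma supports_insertions_scheme:
  assumes "m \<le> n"
  shows "supports_insertions scheme m"
proof -
  let ?P = "\<lambda>H. \<forall>i<m. has_free_slot (occupied H i) (H i)"
  let ?K = "PiM {..<m} (\<lambda>_. \<Pi>\<^sub>M k\<in>(UNIV :: nat set). count_space {1..n})"
  have "Measurable.pred ?K ?P"
  proof -
    have "Measurable.pred ?K (\<lambda>H. \<forall>i\<in>{..<m}. has_free_slot (occupied H i) (H i))"
      by (intro pred_intros_finite measurable_has_free_slot_occupied) auto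
    then show ?thesis by (simp only: Ball_def lessThan_iff)
  qed
  moreover have "?P (run_probes m \<sigma>)" if "\<sigma> \<in> set_pmf (runs m)" for \<sigma>
  proof (intro allI impI)
    fix i assume "i < m"
    then show "has_free_slot (occupied (run_probes m \<sigma>) i) (run_probes m \<sigma> i)"
      using assms by (intro probe_complexity_le(1)[OF valid_runs[OF that, of i]] run_probes_apply) auto
  qed
  ultimately show ?thesis
    unfolding supports_insertions_def keys_scheme
    by (subst AE_distr_iff[OF run_probes_measurable]) (simp_all only: AE_measure_pmf_iff pred_def, blast)
qed

lemma nn_integral_probe_complexity:
  assumes "i < m"
  shows "(\<integral>\<^sup>+H. probe_complexity H i \<partial>keys scheme m) = (\<integral>\<^sup>+\<sigma>. probe_complexity (run_probes m \<sigma>) i \<partial>runs m)"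
  unfolding keys_scheme
  by (intro nn_integral_distr run_probes_measurable, unfold measurable_distr_eq1)
    (rule measurable_probe_complexity[OF assms])

end

lemma worst_insertion_time_eq:
  "worst_expected_insertion_time P m = worst_expected_probe_complexity P m"
  by (simp add: worst_expected_insertion_time_def worst_expected_probe_complexity_def insertion_time_eq)

text \<open>Serves \<delta> above 1/2, where \<open>n / m\<close> is not bounded and the bound
  through the total cost is too weak.\<close>

lemma (in bucket_levels) amortized_le_worst:
  assumes "0 < m"
  shows "amortized_expected_probe_complexity scheme m \<le> worst_expected_probe_complexity scheme m"
proof -
  let ?E = "\<lambda>i. \<integral>\<^sup>+H. probe_complexity H i \<partial>keys scheme m"
  have meas: "(\<lambda>H. probe_complexity H i) \<in> borel_measurable (keys scheme m)" if "i < m" for i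
    unfolding keys_scheme measurable_distr_eq1 by (rule measurable_probe_complexity[OF that])
  have "amortized_expected_probe_complexity scheme m = (\<Sum>i<m. ?E i) / of_nat m"
    unfolding amortized_expected_probe_complexity_def
    using meas by (subst nn_integral_divide, force, subst nn_integral_sum) auto
  also have "\<dots> \<le> (\<Sum>i<m. worst_expected_probe_complexity scheme m) / of_nat m"
    unfolding worst_expected_probe_complexity_def
    by (intro divide_right_mono_ennreal sum_mono SUP_upper)
  also have "\<dots> = worst_expected_probe_complexity scheme m * of_nat m / of_nat m"
    by (simp add: mult.commute)
  also have "\<dots> = worst_expected_probe_complexity scheme m"
    using assms by (intro ennreal_mult_divide_eq) (auto simp: ennreal_of_nat_eq_real_of_nat)
  finally show ?thesis .
qed

context funnel begin

lemma emeasure_bad: "emeasure (runs m) bad \<le> ennreal failure"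
  using prob_bad by (simp add: measure_pmf.emeasure_eq_measure ennreal_leI)

lemma failure_nonneg: "0 \<le> failure"
  using order_trans[OF measure_nonneg prob_bad] .

lemma worst_expected_probe_complexity_le:
  "worst_expected_probe_complexity scheme m \<le> ennreal (\<alpha> * \<beta> + 2 + (\<alpha> * \<beta> + 2 * h + n) * failure)"
  unfolding worst_expected_probe_complexity_def
proof (rule SUP_least)
  fix i assume "i \<in> {..<m}"
  then have i: "i < m" by simp
  let ?c = "\<alpha> * \<beta> + 2 * h + n"
  have "(\<integral>\<^sup>+H. probe_complexity H i \<partial>keys scheme m) = (\<integral>\<^sup>+\<sigma>. probe_complexity (run_probes m \<sigma>) i \<partial>runs m)"
    by (rule nn_integral_probe_complexity[OF i])
  also have "\<dots> \<le> (\<integral>\<^sup>+\<sigma>. of_nat (\<alpha> * \<beta>) + of_nat (overflow_levels \<sigma> i) + of_nat ?c * indicator bad \<sigma> \<partial>runs m)"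
    by (intro nn_integral_mono_AE, unfold AE_measure_pmf_iff, intro ballI probe_complexity_bound)
      (use i valid_runs in \<open>auto simp: run_probes_apply\<close>)
  also have "\<dots> = of_nat (\<alpha> * \<beta>) + (\<integral>\<^sup>+\<sigma>. of_nat (overflow_levels \<sigma> i) \<partial>runs m) + of_nat ?c * emeasure (runs m) bad"
    by (simp add: nn_integral_add nn_integral_cmult measure_pmf.emeasure_space_1)
  also have "\<dots> \<le> of_nat (\<alpha> * \<beta>) + 2 + of_nat ?c * ennreal failure"
    using nn_integral_overflow_levels[OF i] emeasure_bad by (intro add_mono mult_left_mono) auto
  also have "\<dots> = ennreal (real (\<alpha> * \<beta>)) + ennreal 2 + ennreal (real ?c) * ennreal failure"
    by (simp only: ennreal_of_nat_eq_real_of_nat ennreal_numeral)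
  also have "\<dots> = ennreal (real (\<alpha> * \<beta>) + 2 + real ?c * failure)"
    using failure_nonneg by (simp add: ennreal_mult)
  finally show "(\<integral>\<^sup>+H. probe_complexity H i \<partial>keys scheme m)
    \<le> ennreal (\<alpha> * \<beta> + 2 + (\<alpha> * \<beta> + 2 * h + n) * failure)" by (simp add: add_ac)
qed

lemma prob_max_probe_complexity:
  assumes "of_nat (\<alpha> * \<beta> + 2 * h) \<le> B"
  shows "1 - failure \<le> measure (keys scheme m) {H \<in> space (keys scheme m). max_probe_complexity H m \<le> B}"
proof -
  let ?K = "PiM {..<m} (\<lambda>_. \<Pi>\<^sub>M k\<in>(UNIV :: nat set). count_space {1..n})"
  let ?E = "{H \<in> space ?K. max_probe_complexity H m \<le> B}"
  have "(\<lambda>H. max_probe_complexity H m) \<in> borel_measurable ?K"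
    unfolding max_probe_complexity_def
    by (intro borel_measurable_SUP measurable_probe_complexity) auto
  then have E: "?E \<in> sets ?K" by measurable
  have sp: "run_probes m \<sigma> \<in> space ?K" for \<sigma>
    using measurable_space[OF run_probes_measurable, of \<sigma>] by simp
  have "1 - failure \<le> measure_pmf.prob (runs m) (- bad)"
    using prob_bad by (subst measure_pmf.prob_compl[unfolded space_measure_pmf Compl_eq_Diff_UNIV[symmetric]]) auto
  also have "\<dots> \<le> measure_pmf.prob (runs m) (run_probes m -` ?E)"
  proof (rule measure_pmf.finite_measure_mono_AE)
    show "AE \<sigma> in runs m. \<sigma> \<in> - bad \<longrightarrow> \<sigma> \<in> run_probes m -` ?E"
      unfolding AE_measure_pmf_iff
    proof (intro ballI impI)
      fix \<sigma> assume "\<sigma> \<in> set_pmf (runs m)" "\<sigma> \<in> - bad"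
      then have "max_probe_complexity (run_probes m \<sigma>) m \<le> of_nat (\<alpha> * \<beta> + 2 * h)"
        using valid_runs by (intro max_probe_complexity_if_good) (auto simp: run_probes_apply)
      then show "\<sigma> \<in> run_probes m -` ?E"
        using sp assms by (auto intro: order_trans)
    qed
  qed simp
  also have "\<dots> = measure (distr (measure_pmf (runs m)) ?K (run_probes m)) ?E"
    using measure_distr[OF run_probes_measurable E] by simp
  finally show ?thesis unfolding keys_scheme by simp
qed

lemma amortized_expected_probe_complexity_le:
  assumes "0 < m"
  shows "amortized_expected_probe_complexity scheme m
    \<le> ennreal (515 * \<beta> * n / m + (\<alpha> * \<beta> + 2 * h + n) * failure)"
proof -
  let ?c = "\<alpha> * \<beta> + 2 * h + n"
  let ?K = "PiM {..<m} (\<lambda>_. \<Pi>\<^sub>M k\<in>(UNIV :: nat set). count_space {1..n})"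
  have "(\<lambda>H. (\<Sum>i<m. probe_complexity H i) / of_nat m) \<in> borel_measurable ?K"
    by (intro borel_measurable_divide_ennreal borel_measurable_sum measurable_probe_complexity) auto
  then have "amortized_expected_probe_complexity scheme m
    = (\<integral>\<^sup>+\<sigma>. (\<Sum>i<m. probe_complexity (run_probes m \<sigma>) i) / of_nat m \<partial>runs m)"
    unfolding amortized_expected_probe_complexity_def keys_scheme
    by (intro nn_integral_distr[OF run_probes_measurable], unfold measurable_distr_eq1)
  also have "\<dots> \<le> (\<integral>\<^sup>+\<sigma>. of_nat (515 * \<beta> * n) / of_nat m + of_nat ?c * indicator bad \<sigma> \<partial>runs m)"
  proof (intro nn_integral_mono_AE, unfold AE_measure_pmf_iff, intro ballI)
    fix \<sigma> assume "\<sigma> \<in> set_pmf (runs m)"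
    then have v: "valid (\<sigma> k)" for k by (rule valid_runs)
    show "(\<Sum>i<m. probe_complexity (run_probes m \<sigma>) i) / of_nat m
        \<le> of_nat (515 * \<beta> * n) / of_nat m + of_nat ?c * indicator bad \<sigma>"
    proof (cases "\<sigma> \<in> bad")
      case False
      have "(\<Sum>i<m. probe_complexity (run_probes m \<sigma>) i) \<le> of_nat (515 * \<beta> * n)"
        by (rule total_if_good[OF v False]) (simp add: run_probes_apply)
      then show ?thesis using False by (simp add: divide_right_mono_ennreal)
    next
      case True
      have "(\<Sum>i<m. probe_complexity (run_probes m \<sigma>) i) \<le> (\<Sum>i<m. of_nat ?c)"
      proof (rule sum_mono)
        fix i assume "i \<in> {..<m}"
        then show "probe_complexity (run_probes m \<sigma>) i \<le> of_nat ?c"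
          using probe_complexity_le(2)[of "\<sigma> i" "run_probes m \<sigma>" i] v m_le
          by (simp add: sum_width run_probes_apply)
      qed
      then have "(\<Sum>i<m. probe_complexity (run_probes m \<sigma>) i) / of_nat m \<le> of_nat ?c * of_nat m / of_nat m"
        by (intro divide_right_mono_ennreal) (simp add: mult.commute)
      also have "\<dots> = of_nat ?c"
        using assms by (intro ennreal_mult_divide_eq) (auto simp: ennreal_of_nat_eq_real_of_nat)
      also have "\<dots> \<le> of_nat (515 * \<beta> * n) / of_nat m + of_nat ?c * indicator bad \<sigma>"
        using True by simp
      finally show ?thesis .
    qed
  qed
  also have "\<dots> = of_nat (515 * \<beta> * n) / of_nat m + of_nat ?c * emeasure (runs m) bad"
    by (simp add: nn_integral_add nn_integral_cmult measure_pmf.emeasure_space_1)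
  also have "\<dots> \<le> of_nat (515 * \<beta> * n) / of_nat m + of_nat ?c * ennreal failure"
    using emeasure_bad by (intro add_mono mult_left_mono) auto
  also have "\<dots> = ennreal (real (515 * \<beta> * n)) / ennreal (real m) + ennreal (real ?c) * ennreal failure"
    by (simp only: ennreal_of_nat_eq_real_of_nat)
  also have "\<dots> = ennreal (real (515 * \<beta> * n) / m) + ennreal (real ?c * failure)"
    using failure_nonneg assms
    by (intro arg_cong2[where f = "(+)"] divide_ennreal ennreal_mult[symmetric]) auto
  also have "\<dots> = ennreal (real (515 * \<beta> * n) / m + real ?c * failure)"
    using failure_nonneg by (intro ennreal_plus[symmetric]) auto
  finally show ?thesis by simp
qed

end

section \<open>Asymptotics\<close>

definition funnel_scheme :: "nat \<Rightarrow> nat \<Rightarrow> nat \<Rightarrow> probe_seq measure" where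
  "funnel_scheme n l h =
     bucket_levels.scheme n (512 * l + 2 * h) (funnel_buckets n l) (funnel_width l)"

text \<open>Fallback for the finitely many \<open>n\<close> at which the funnel conditions fail:
  without levels, each key scans the array from slot 1.\<close>

definition sweep_scheme :: "nat \<Rightarrow> probe_seq measure" where
  "sweep_scheme n = bucket_levels.scheme n 0 (\<lambda>_. 0) (\<lambda>_. 0)"

lemma sweep_scheme:
  assumes "1 \<le> n"
  shows "probe_distribution n (sweep_scheme n)" "m \<le> n \<Longrightarrow> supports_insertions (sweep_scheme n) m"
proof -
  interpret bucket_levels n 0 "\<lambda>_. 0" "\<lambda>_. 0"
    by unfold_locales (use assms in auto)
  show "probe_distribution n (sweep_scheme n)" "m \<le> n \<Longrightarrow> supports_insertions (sweep_scheme n) m"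
    unfolding sweep_scheme_def using probe_distribution_scheme supports_insertions_scheme by auto
qed

text \<open>An upper bound for \<open>failure\<close> at \<open>\<theta> = n powr (1 / 4)\<close>
  that is free of \<delta>: the factors \<open>\<alpha>\<close> and \<open>h\<close> are replaced by
  \<open>n\<close>, and the exponent \<open>h\<close> by its lower bound
  \<open>log log n\<close>.\<close>

definition failure_bound :: "nat \<Rightarrow> real" where
  "failure_bound n = 3 * real n / 2 powr (real n powr (1 / 4)) + 2 * real n / 2 powr (real n powr (1 / 4) / 2)
     + real n * real n powr (- log 2 (log 2 (real n)) / 2)"

lemma failure_bound_superpolynomial:
  "\<forall>\<^sub>F n in sequentially. failure_bound n \<le> real n powr - c"
proof -
  have "((\<lambda>n::nat. 3 * real n / 2 powr (real n powr (1/4)) * real n powr c) \<longlongrightarrow> 0) sequentially"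
    "((\<lambda>n::nat. 2 * real n / 2 powr (real n powr (1/4) / 2) * real n powr c) \<longlongrightarrow> 0) sequentially"
    "((\<lambda>n::nat. real n * real n powr (- log 2 (log 2 (real n)) / 2) * real n powr c) \<longlongrightarrow> 0) sequentially"
    by real_asymp+
  from tendsto_add[OF tendsto_add[OF this(1,2)] this(3)]
  have "((\<lambda>n. failure_bound n * real n powr c) \<longlongrightarrow> 0) sequentially"
    by (simp add: failure_bound_def distrib_right)
  then have "\<forall>\<^sub>F n in sequentially. failure_bound n * real n powr c < 1"
    by (rule order_tendstoD(2)) simp
  moreover have "\<forall>\<^sub>F n :: nat in sequentially. 0 < n" by (rule eventually_gt_at_top)
  ultimately show ?thesis
  proof eventually_elim
    case (elim n)
    then have "failure_bound n * real n powr c * real n powr - c \<le> 1 * real n powr - c"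
      by (intro mult_right_mono) auto
    then show ?case using elim by (simp add: powr_minus field_simps)
  qed
qed

section \<open>Numerical bounds for a single \<open>n\<close>\<close>

context funnel begin

lemma scheme_eq: "scheme = funnel_scheme n l h"
  by (simp add: funnel_scheme_def L_def \<alpha>_def)

lemma l_le_power: "real l \<le> 2 ^ l"
  using of_nat_less_two_power[of l, where 'a = real] by simp

lemma funnel_cost_le: "512 * (\<alpha> * \<beta>) \<le> real n"
proof -
  have "512 * 512 * real \<beta> * l \<le> 512 * 512 * real \<beta> * 2 ^ l"
    using l_le_power by (intro mult_left_mono) auto
  then show ?thesis using l_small' by (simp add: \<alpha>_def mult_ac)
qed

lemma alpha_le: "real \<alpha> \<le> n"
proof -
  have "real \<alpha> * 1 \<le> real \<alpha> * real \<beta>" using beta_pos by (intro mult_left_mono) auto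
  then show ?thesis using funnel_cost_le by simp
qed

lemma failure_le:
  assumes "log 2 (log 2 n) \<le> h" "real h \<le> n" "\<theta> = n powr (1 / 4)"
  shows "failure \<le> failure_bound n"
proof -
  have "(1 / sqrt n) ^ h = n powr (- real h / 2)"
  proof -
    have "(1 / sqrt n) ^ h = (n powr (- 1 / 2)) powr real h"
      using n_ge by (simp add: powr_realpow powr_minus_divide powr_half_sqrt flip: powr_realpow)
    then show ?thesis by (simp add: powr_powr)
  qed
  also have "\<dots> \<le> n powr (- log 2 (log 2 (real n)) / 2)"
    using n_ge assms(1) by (intro powr_mono) auto
  finally have "n * (1 / sqrt n) ^ h \<le> n * n powr (- log 2 (log 2 (real n)) / 2)"
    by (intro mult_left_mono) auto
  moreover have "3 * \<alpha> / 2 powr \<theta> \<le> 3 * n / 2 powr \<theta>"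
    using alpha_le by (intro divide_right_mono) auto
  moreover have "2 * h / 2 powr (\<theta> / 2) \<le> 2 * n / 2 powr (\<theta> / 2)"
    using assms by (intro divide_right_mono) auto
  ultimately show ?thesis
    unfolding failure_def failure_bound_def assms(3)[symmetric] by simp
qed

text \<open>In a bad run a key costs at most \<open>\<alpha> * \<beta> + 2 * h + n\<close>, so
  failure probability \<open>n powr - 2\<close> limits the share of bad runs in an expectation to
  1.\<close>

lemma failure_cost_le:
  assumes "failure \<le> n powr - 2" "4 * real h \<le> n"
  shows "(\<alpha> * \<beta> + 2 * h + n) * failure \<le> 1"
proof -
  have "real (\<alpha> * \<beta> + 2 * h + n) \<le> 2 * real n"
    using funnel_cost_le assms(2) by simp
  then have "real (\<alpha> * \<beta> + 2 * h + n) * failure \<le> 2 * real n * n powr - 2"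
    using assms(1) failure_nonneg by (intro mult_mono) auto
  also have "\<dots> = 2 / n"
    using n_ge by (simp add: powr_minus powr_numeral power2_eq_square field_simps)
  also have "\<dots> \<le> 1" using n_ge by simp
  finally show ?thesis .
qed

lemma cost_le:
  fixes x :: real
  assumes "real l \<le> x + 4" "0 \<le> x"
  shows "\<alpha> * \<beta> \<le> 1024 * x\<^sup>2 + 50176"
proof -
  have "real l * real \<beta> \<le> (x + 7) * (x + 7)"
    using assms by (intro mult_mono) (auto simp: \<beta>_def)
  \<comment> \<open>Squareness of \<open>x - 7\<close> removes the mixed term; the constant becomes
    512 * 98 = 50176.\<close>
  also have "\<dots> \<le> 2 * x\<^sup>2 + 98"
    using zero_le_square[of "x - 7"] by (simp add: power2_eq_square algebra_simps)
  finally show ?thesis by (simp add: \<alpha>_def)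
qed

lemma worst_case_bound:
  assumes "failure \<le> n powr - 2" "4 * real h \<le> n" "real l \<le> x + 4" "0 \<le> x"
  shows "worst_expected_probe_complexity scheme m \<le> ennreal (60000 * (1 + x\<^sup>2))"
proof -
  have "worst_expected_probe_complexity scheme m \<le> ennreal (\<alpha> * \<beta> + 2 + (\<alpha> * \<beta> + 2 * h + n) * failure)"
    by (rule worst_expected_probe_complexity_le)
  also have "\<dots> \<le> ennreal (60000 * (1 + x\<^sup>2))"
  proof (rule ennreal_leI)
    have "real (\<alpha> * \<beta>) \<le> 1024 * x\<^sup>2 + 50176" by (rule cost_le) fact+
    moreover have "0 \<le> x\<^sup>2" by simp
    moreover have "a + 2 + f \<le> 60000 * (1 + s)" if "a \<le> 1024 * s + 50176" "0 \<le> s" "f \<le> 1" for a s f :: real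
      using that by simp
    ultimately have "real (\<alpha> * \<beta>) + 2 + real (\<alpha> * \<beta> + 2 * h + n) * failure \<le> 60000 * (1 + x\<^sup>2)"
      using failure_cost_le[OF assms(1,2)] by blast
    then show "real (\<alpha> * \<beta> + 2) + real (\<alpha> * \<beta> + 2 * h + n) * failure \<le> 60000 * (1 + x\<^sup>2)"
      by (simp only: of_nat_add of_nat_numeral)
  qed
  finally show ?thesis .
qed

lemma amortized_bound:
  assumes "failure \<le> n powr - 2" "4 * real h \<le> n" "real l \<le> x + 4" "0 \<le> x" "n \<le> 2 * m"
  shows "amortized_expected_probe_complexity scheme m \<le> ennreal (60000 * (1 + x))"
proof -
  have m: "0 < m" using assms(5) n_ge by simp
  have "amortized_expected_probe_complexity scheme m
    \<le> ennreal (515 * \<beta> * n / m + (\<alpha> * \<beta> + 2 * h + n) * failure)"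
    by (rule amortized_expected_probe_complexity_le[OF m])
  also have "\<dots> \<le> ennreal (60000 * (1 + x))"
  proof (rule ennreal_leI)
    have "real n \<le> real (2 * m)" using assms(5) by (rule of_nat_mono)
    then have "real (515 * \<beta> * n) / m \<le> 515 * \<beta> * 2"
      using m mult_right_mono[of "real n" "real m * 2" "515 * real \<beta>"]
      by (simp add: divide_le_eq mult_ac)
    also have "\<dots> \<le> 1030 * (x + 7)" using assms(3) by (simp add: \<beta>_def)
    finally show "real (515 * \<beta> * n) / m + real (\<alpha> * \<beta> + 2 * h + n) * failure \<le> 60000 * (1 + x)"
      using failure_cost_le[OF assms(1,2)] assms(4) by (simp add: algebra_simps)
  qed
  finally show ?thesis .
qed

lemma high_probability_bound:
  assumes "failure \<le> n powr - c" "real l \<le> x + 4" "0 \<le> x" "real h \<le> y + 1" "1 \<le> y"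
  shows "1 - n powr - c \<le> measure (keys scheme m) {H \<in> space (keys scheme m).
     max_probe_complexity H m \<le> ennreal (60000 * (x\<^sup>2 + y))}"
proof -
  have "1 - failure \<le> measure (keys scheme m) {H \<in> space (keys scheme m).
     max_probe_complexity H m \<le> ennreal (60000 * (x\<^sup>2 + y))}"
  proof (rule prob_max_probe_complexity)
    have "real (\<alpha> * \<beta>) \<le> 1024 * x\<^sup>2 + 50176" by (rule cost_le) fact+
    moreover have "0 \<le> x\<^sup>2" by simp
    moreover have "a + 2 * real h \<le> 60000 * (s + y)" if "a \<le> 1024 * s + 50176" "0 \<le> s" for a s :: real
      using that assms(4,5) by simp
    ultimately have "real (\<alpha> * \<beta>) + 2 * real h \<le> 60000 * (x\<^sup>2 + y)"
      by blast
    then have "real (\<alpha> * \<beta> + 2 * h) \<le> 60000 * (x\<^sup>2 + y)"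
      by (simp only: of_nat_add of_nat_mult of_nat_numeral)
    then show "of_nat (\<alpha> * \<beta> + 2 * h) \<le> ennreal (60000 * (x\<^sup>2 + y))"
      by (subst ennreal_of_nat_eq_real_of_nat) (rule ennreal_leI)
  qed
  then show ?thesis using assms(1) by linarith
qed

end

text \<open>The summand 3 yields \<open>2 ^ depth d \<ge> 8 / d\<close>, enough for
  \<open>D_ge\<close> after rounding \<open>d * n\<close> down, and makes
  \<open>l + 3 \<le> 2 ^ l\<close> available.\<close>

definition depth :: "real \<Rightarrow> nat" where
  "depth d = nat \<lceil>log 2 (1 / d)\<rceil> + 3"

definition loglog :: "nat \<Rightarrow> nat" where
  "loglog n = nat \<lceil>log 2 (log 2 (real n))\<rceil>"

lemma depth_bounds:
  assumes "0 < d" "d < 1"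
  shows "0 \<le> log 2 (1 / d)" "real (depth d) \<le> log 2 (1 / d) + 4" "2 ^ depth d \<le> 16 / d" "8 / d \<le> 2 ^ depth d"
    "3 \<le> depth d"
proof -
  show pos: "0 \<le> log 2 (1 / d)" using assms by simp
  then have *: "log 2 (1 / d) + 3 \<le> real (depth d)" "real (depth d) \<le> log 2 (1 / d) + 4"
    unfolding depth_def by linarith+
  show "real (depth d) \<le> log 2 (1 / d) + 4" by fact
  have "2 powr (log 2 (1 / d)) = 1 / d"
    using assms by (intro powr_log_cancel) auto
  then have "2 powr (log 2 (1 / d) + 3) = 8 / d" "2 powr (log 2 (1 / d) + 4) = 16 / d"
    by (simp_all add: powr_add)
  moreover have "2 ^ depth d = 2 powr real (depth d)" by (simp add: powr_realpow)
  ultimately show "2 ^ depth d \<le> 16 / d" "8 / d \<le> 2 ^ depth d"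
    using powr_mono[OF *(1), of 2] powr_mono[OF *(2), of 2] by simp_all
  show "3 \<le> depth d" by (simp add: depth_def)
qed

lemma loglog_bounds:
  assumes "1 \<le> log 2 (log 2 (real n))"
  shows "log 2 (log 2 (real n)) \<le> loglog n" "loglog n \<le> log 2 (log 2 (real n)) + 1" "1 \<le> loglog n"
    "n \<le> 2 ^ (2 ^ loglog n)" "2 ^ loglog n \<le> 2 * log 2 (real n)"
proof -
  show *: "log 2 (log 2 (real n)) \<le> loglog n" "loglog n \<le> log 2 (log 2 (real n)) + 1"
    using assms unfolding loglog_def by linarith+
  show "1 \<le> loglog n" using * assms by linarith
  have n: "0 < real n" using assms by (cases n) (auto simp: log_def)
  have "log 2 (real n) \<noteq> 0" using assms by (auto simp: log_def)
  moreover have "0 \<le> log 2 (real n)" using n by simp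
  ultimately have pos: "0 < log 2 (real n)" by linarith
  have cancel: "2 powr (log 2 (log 2 (real n))) = log 2 (real n)"
    using pos by (intro powr_log_cancel) auto
  have pw: "2 ^ loglog n = 2 powr real (loglog n)" by (simp add: powr_realpow)
  have "log 2 (real n) \<le> 2 ^ loglog n"
    unfolding pw by (subst cancel[symmetric]) (rule powr_mono[OF *(1)], simp)
  then have "2 powr (log 2 (real n)) \<le> 2 powr (2 ^ loglog n)"
    by (intro powr_mono) auto
  also have "2 powr (log 2 (real n)) = n" using n by (intro powr_log_cancel) auto
  also have "2 powr (2 ^ loglog n) = real (2 ^ (2 ^ loglog n))"
    using powr_realpow[of 2 "2 ^ loglog n"] by simp
  finally show "n \<le> 2 ^ (2 ^ loglog n)" by (simp only: of_nat_le_iff)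
  have "2 powr real (loglog n) \<le> 2 powr (log 2 (log 2 (real n)) + 1)"
    by (rule powr_mono[OF *(2)]) simp
  then show "2 ^ loglog n \<le> 2 * log 2 (real n)"
    unfolding pw by (simp add: powr_add cancel)
qed

lemma num_insertions_eq:
  assumes "0 < d" "d < 1"
  shows "num_insertions n d + nat \<lfloor>d * real n\<rfloor> = n"
proof -
  have "d * real n \<le> 1 * real n" using assms by (intro mult_right_mono) auto
  then have "nat \<lfloor>d * real n\<rfloor> \<le> n" by linarith
  then show ?thesis by (simp add: num_insertions_def)
qed

text \<open>A fixed small power suffices: with 1/64 the most demanding condition,
  \<open>\<theta>_overflow\<close>, reads \<open>n powr (1/32 + 1/4 + 1/2)\<close> times a power of
  \<open>log n\<close>, still below \<open>n\<close>. Half of the exponent is for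
  \<open>1 / \<delta> n\<close>, half for the factor 16.\<close>

lemma depth_subpolynomial:
  assumes pos: "\<forall>n\<ge>1. 0 < \<delta> n \<and> \<delta> n < 1" and sub: "subpolynomial (\<lambda>n. 1 / \<delta> n)"
  shows "\<forall>\<^sub>F n in sequentially. 2 ^ depth (\<delta> n) \<le> real n powr (1 / 64)"
proof -
  obtain e where e: "e \<longlonglongrightarrow> 0" "\<forall>\<^sub>F n in sequentially. 1 / \<delta> n = real n powr e n"
    using sub by (auto simp: subpolynomial_def)
  have "\<forall>\<^sub>F n in sequentially. e n < 1 / 128"
    using e(1) by (rule order_tendstoD(2)) simp
  moreover have "\<forall>\<^sub>F n::nat in sequentially. 16 \<le> real n powr (1/128)"
    by real_asymp
  moreover note e(2) eventually_ge_at_top[of 1]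
  ultimately show ?thesis
  proof eventually_elim
    case (elim n)
    have "2 ^ depth (\<delta> n) \<le> 16 * (1 / \<delta> n)"
      using depth_bounds(3)[of "\<delta> n"] pos elim by auto
    also have "\<dots> \<le> real n powr (1 / 128) * real n powr (1 / 128)"
      unfolding elim(3) using elim by (intro mult_mono powr_mono) auto
    also have "\<dots> = real n powr (1 / 64)"
      by (simp flip: powr_add)
    finally show ?case .
  qed
qed

lemma eventually_loglog_ge: "\<forall>\<^sub>F n::nat in sequentially. 1 \<le> log 2 (log 2 (real n))"
  by real_asymp

lemma le_power_two: "3 \<le> l \<Longrightarrow> real l + 3 \<le> 2 ^ l"
proof (induction l rule: nat_induct_at_least)
  case (Suc l)
  then show ?case by simp
qed simp

lemma eventually_funnel:
  assumes pos: "\<forall>n\<ge>1. 0 < \<delta> n \<and> \<delta> n < 1" and sub: "subpolynomial (\<lambda>n. 1 / \<delta> n)"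
  shows "\<forall>\<^sub>F n in sequentially. funnel n (depth (\<delta> n)) (loglog n) (num_insertions n (\<delta> n))
    (nat \<lfloor>\<delta> n * real n\<rfloor>) (real n powr (1 / 4))"
proof -
  \<comment> \<open>The size conditions of the locale after replacing \<open>2 ^ l * 2 ^ l\<close>
    by \<open>n powr (1/32)\<close>, its square by \<open>n powr (1/16)\<close>, and
    \<open>2 ^ h\<close> by \<open>2 * log 2 n\<close>.\<close>
  have ev: "\<forall>\<^sub>F n::nat in sequentially. 512 * 512 * real n powr (1/32) \<le> n"
    "\<forall>\<^sub>F n::nat in sequentially. 512 * real n powr (1/16) * (real n powr (1/4) + 2) \<le> n"
    "\<forall>\<^sub>F n::nat in sequentially. real n powr (1/32) * real n powr (1/4) * (16 * (log 2 (real n))\<^sup>2) * sqrt n \<le> n"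
    "\<forall>\<^sub>F n::nat in sequentially. real n powr (1/64) \<le> n"
    by real_asymp+
  show ?thesis
    using depth_subpolynomial[OF assms] eventually_loglog_ge ev eventually_ge_at_top[of 16]
  proof eventually_elim
    case (elim n)
    define l where "l = depth (\<delta> n)"
    define h where "h = loglog n"
    have d: "0 < \<delta> n" "\<delta> n < 1" using pos elim by auto
    note D = depth_bounds[OF d, folded l_def]
    note LL = loglog_bounds[OF elim(2), folded h_def]
    have n: "1 \<le> real n" using elim by simp
    have v: "2 ^ l \<le> real n powr (1 / 64)" using elim by (simp add: l_def)
    have l3: "real l + 3 \<le> 2 ^ l" using D(5) by (rule le_power_two)
    have pp: "real n powr (1 / 64) * real n powr (1 / 64) = real n powr (1 / 32)"
      "real n powr (1 / 32) * real n powr (1 / 32) = real n powr (1 / 16)"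
      by (simp_all flip: powr_add)
    have "2 ^ l * 2 ^ l \<le> real n powr (1 / 64) * real n powr (1 / 64)"
      using v by (intro mult_mono) auto
    then have v2: "2 ^ l * 2 ^ l \<le> real n powr (1 / 32)" by (simp only: pp)
    have four: "(4 :: real) ^ l = 2 ^ l * 2 ^ l" by (simp flip: power_mult_distrib)
    show "funnel n (depth (\<delta> n)) (loglog n) (num_insertions n (\<delta> n))
      (nat \<lfloor>\<delta> n * real n\<rfloor>) (real n powr (1 / 4))"
      unfolding l_def[symmetric] h_def[symmetric]
    proof
      show "16 \<le> n" "1 \<le> l" "1 \<le> h" "n \<le> 2 ^ (2 ^ h)"
        using elim D LL by auto
      show "num_insertions n (\<delta> n) + nat \<lfloor>\<delta> n * real n\<rfloor> \<le> n"
        using num_insertions_eq[OF d, of n] by simp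
      show "1 \<le> real n powr (1 / 4)" using n by (intro ge_one_powr_ge_zero) auto
      show "3 * n \<le> nat \<lfloor>\<delta> n * real n\<rfloor> * 2 ^ l"
      proof -
        have "8 * real n = 8 / \<delta> n * (\<delta> n * n)" using d by simp
        also have "\<dots> \<le> 2 ^ l * (\<delta> n * n)" using D(4) d by (intro mult_right_mono) auto
        \<comment> \<open>Rounding \<open>\<delta> n * n\<close> down costs at most
          \<open>2 ^ l \<le> n\<close>, so more than the required \<open>3 * n\<close> remains of
          \<open>8 * n\<close>.\<close>
        also have "\<dots> \<le> 2 ^ l * (real (nat \<lfloor>\<delta> n * real n\<rfloor>) + 1)"
          using d by (intro mult_left_mono) (linarith, simp)
        also have "\<dots> \<le> 2 ^ l * real (nat \<lfloor>\<delta> n * real n\<rfloor>) + n"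
        proof -
          have "(2 :: real) ^ l \<le> n" using v elim(6) by linarith
          then show ?thesis by (simp add: distrib_left)
        qed
        finally have "real (3 * n) \<le> real (nat \<lfloor>\<delta> n * real n\<rfloor> * 2 ^ l)"
          by (simp add: mult.commute)
        then show ?thesis by (simp only: of_nat_le_iff)
      qed
      show "512 * 512 * (l + 3) * 2 ^ l \<le> n"
      proof -
        have "512 * 512 * ((real l + 3) * 2 ^ l) \<le> 512 * 512 * (2 ^ l * 2 ^ l)"
          using l3 by (intro mult_left_mono mult_right_mono) auto
        also have "\<dots> \<le> 512 * 512 * real n powr (1 / 32)" using v2 by simp
        also have "\<dots> \<le> n" using elim by simp
        finally have "real (512 * 512 * (l + 3) * 2 ^ l) \<le> real n" by (simp add: mult_ac)
        then show ?thesis by (simp only: of_nat_le_iff)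
      qed
      show "4 ^ l * (512 * (real l + 3) * 2 ^ l) * (real n powr (1 / 4) + 2) \<le> real n"
      proof -
        have "4 ^ l * (512 * (real l + 3) * 2 ^ l) = 512 * ((2 ^ l * 2 ^ l) * ((real l + 3) * 2 ^ l))"
          by (simp add: four)
        also have "\<dots> \<le> 512 * ((2 ^ l * 2 ^ l) * (2 ^ l * 2 ^ l))"
          using l3 by (intro mult_left_mono mult_right_mono) auto
        also have "\<dots> \<le> 512 * (real n powr (1 / 32) * real n powr (1 / 32))"
          using v2 by (intro mult_left_mono mult_mono) auto
        also have "\<dots> = 512 * real n powr (1 / 16)" by (simp only: pp)
        finally have "4 ^ l * (512 * (real l + 3) * 2 ^ l) * (real n powr (1 / 4) + 2)
           \<le> 512 * real n powr (1 / 16) * (real n powr (1 / 4) + 2)"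
          by (intro mult_right_mono) auto
        then show ?thesis using elim by linarith
      qed
      show "4 ^ l * real n powr (1 / 4) * 2 ^ (2 * h + 2) * sqrt n \<le> real n"
      proof -
        have "(2 :: real) ^ (2 * h + 2) = 4 * (2 ^ h)\<^sup>2"
          by (simp add: power_add power_even_eq)
        also have "\<dots> \<le> 4 * (2 * log 2 (real n))\<^sup>2"
          using LL(5) by (intro mult_left_mono power_mono) auto
        finally have "(2 :: real) ^ (2 * h + 2) \<le> 16 * (log 2 (real n))\<^sup>2"
          by (simp add: power_mult_distrib)
        then have "4 ^ l * real n powr (1 / 4) * 2 ^ (2 * h + 2) * sqrt n
          \<le> real n powr (1/32) * real n powr (1/4) * (16 * (log 2 (real n))\<^sup>2) * sqrt n"
          unfolding four using v2 by (intro mult_right_mono mult_mono) auto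
        then show ?thesis using elim by linarith
      qed
    qed
  qed
qed

theorem theorem2:
  "\<exists>(C :: real) (K :: real \<Rightarrow> real). \<forall>\<delta> :: nat \<Rightarrow> real.
     (\<forall>n\<ge>1. 0 < \<delta> n \<and> \<delta> n < 1) \<and> subpolynomial (\<lambda>n. 1 / \<delta> n) \<longrightarrow>
     (\<exists>P :: nat \<Rightarrow> probe_seq measure.
        (\<forall>n\<ge>1. probe_distribution n (P n) \<and>
                supports_insertions (P n) (num_insertions n (\<delta> n))) \<and>
        (\<forall>\<^sub>F n in sequentially.
           worst_expected_probe_complexity (P n) (num_insertions n (\<delta> n))
             \<le> ennreal (C * (1 + (log 2 (1 / \<delta> n))\<^sup>2))) \<and>
        (\<forall>\<^sub>F n in sequentially.
           worst_expected_insertion_time (P n) (num_insertions n (\<delta> n))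
             \<le> ennreal (C * (1 + (log 2 (1 / \<delta> n))\<^sup>2))) \<and>
        (\<forall>c>0. \<forall>\<^sub>F n in sequentially.
           measure (keys (P n) (num_insertions n (\<delta> n)))
             {H \<in> space (keys (P n) (num_insertions n (\<delta> n))).
                max_probe_complexity H (num_insertions n (\<delta> n))
                  \<le> ennreal (K c * ((log 2 (1 / \<delta> n))\<^sup>2 + log 2 (log 2 (real n))))}
             \<ge> 1 - real n powr - c) \<and>
        (\<forall>\<^sub>F n in sequentially.
           amortized_expected_probe_complexity (P n) (num_insertions n (\<delta> n))
             \<le> ennreal (C * (1 + log 2 (1 / \<delta> n)))))"
proof (rule exI[of _ "60000 :: real"], rule exI[of _ "\<lambda>_ :: real. 60000 :: real"], intro allI impI)
  \<comment> \<open>The constant 60000 rounds up 50176 plus lower-order terms. \<open>K\<close> does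
    not vary with \<open>c\<close>, because the failure bound beats every power of
    \<open>n\<close>.\<close>
  fix \<delta> :: "nat \<Rightarrow> real"
  assume asm: "(\<forall>n\<ge>1. 0 < \<delta> n \<and> \<delta> n < 1) \<and> subpolynomial (\<lambda>n. 1 / \<delta> n)"
  define m where "m = (\<lambda>n. num_insertions n (\<delta> n))"
  define x where "x = (\<lambda>n. log 2 (1 / \<delta> n))"
  define F where "F = (\<lambda>n. funnel n (depth (\<delta> n)) (loglog n) (m n) (nat \<lfloor>\<delta> n * real n\<rfloor>) (real n powr (1 / 4)))"
  define P where "P = (\<lambda>n. if F n then funnel_scheme n (depth (\<delta> n)) (loglog n) else sweep_scheme n)"
  have F: "\<forall>\<^sub>F n in sequentially. F n"
    unfolding F_def m_def using eventually_funnel asm by blast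
  have small: "\<forall>\<^sub>F n::nat in sequentially. log 2 (log 2 (real n)) + 1 \<le> n / 4"
    by real_asymp
  have supports: "probe_distribution n (P n) \<and> supports_insertions (P n) (m n)" if "1 \<le> n" for n
  proof (cases "F n")
    case True
    then interpret funnel n "depth (\<delta> n)" "loglog n" "m n" "nat \<lfloor>\<delta> n * real n\<rfloor>" "real n powr (1 / 4)"
      by (simp add: F_def)
    show ?thesis
      using True probe_distribution_scheme supports_insertions_scheme[of "m n"] m_le
      by (simp add: P_def scheme_eq)
  next
    case False
    then show ?thesis using sweep_scheme[OF that] by (simp add: P_def m_def num_insertions_def)
  qed
  have main: "worst_expected_probe_complexity (P n) (m n) \<le> ennreal (60000 * (1 + (x n)\<^sup>2)) \<and>
      amortized_expected_probe_complexity (P n) (m n) \<le> ennreal (60000 * (1 + x n))"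
    if "F n" "1 \<le> log 2 (log 2 (real n))" "log 2 (log 2 (real n)) + 1 \<le> n / 4"
      "failure_bound n \<le> real n powr - 2" for n
  proof -
    interpret funnel n "depth (\<delta> n)" "loglog n" "m n" "nat \<lfloor>\<delta> n * real n\<rfloor>" "real n powr (1 / 4)"
      using that(1) by (simp add: F_def)
    have d: "0 < \<delta> n" "\<delta> n < 1" using asm n_ge by auto
    have f: "failure \<le> real n powr - 2"
      using failure_le loglog_bounds[OF that(2)] that by linarith
    have h: "4 * real (loglog n) \<le> n" using loglog_bounds[OF that(2)] that(3) by linarith
    have x: "real (depth (\<delta> n)) \<le> x n + 4" "0 \<le> x n"
      using depth_bounds[OF d] by (simp_all add: x_def)
    note worst = worst_case_bound[OF f h x]
    \<comment> \<open>For \<delta> at most 1/2, \<open>n / m\<close> is at most 2. Otherwise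
      \<open>x n \<le> 1\<close>, hence the square of \<open>x n\<close> is at most
      \<open>x n\<close> and the worst-case bound is already good enough.\<close>
    have "amortized_expected_probe_complexity scheme (m n) \<le> ennreal (60000 * (1 + x n))"
    proof (cases "\<delta> n \<le> 1 / 2")
      case True
      have "real (m n) + real (nat \<lfloor>\<delta> n * real n\<rfloor>) = n"
        using num_insertions_eq[OF d, of n] unfolding m_def by linarith
      moreover have "\<delta> n * n \<le> 1 / 2 * n" using True by (intro mult_right_mono) auto
      moreover have "real (nat \<lfloor>\<delta> n * real n\<rfloor>) \<le> \<delta> n * n" using d by simp
      ultimately have "n \<le> 2 * m n" by linarith
      then show ?thesis using amortized_bound[OF f h x] by simp
    next
      case False
      have "\<delta> n * n < 1 * real n" using d n_ge by (intro mult_strict_right_mono) auto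
      then have "nat \<lfloor>\<delta> n * real n\<rfloor> < n" using d n_ge by linarith
      then have "0 < m n" by (simp add: m_def num_insertions_def)
      then have "amortized_expected_probe_complexity scheme (m n) \<le> ennreal (60000 * (1 + (x n)\<^sup>2))"
        using amortized_le_worst worst order_trans by blast
      also have "\<dots> \<le> ennreal (60000 * (1 + x n))"
      proof -
        have "1 / \<delta> n \<le> 2" using False d by (simp add: field_simps)
        then have "x n \<le> log 2 2" unfolding x_def using d by (intro log_mono) auto
        then have "x n * x n \<le> 1 * x n" using x(2) by (intro mult_right_mono) auto
        then show ?thesis by (intro ennreal_leI) (simp add: power2_eq_square)
      qed
      finally show ?thesis .
    qed
    then show ?thesis using worst that(1) by (simp add: P_def scheme_eq)
  qed
  have main_ev: "\<forall>\<^sub>F n in sequentially. worst_expected_probe_complexity (P n) (m n) \<le> ennreal (60000 * (1 + (x n)\<^sup>2)) \<and>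
      amortized_expected_probe_complexity (P n) (m n) \<le> ennreal (60000 * (1 + x n))"
    using F eventually_loglog_ge small failure_bound_superpolynomial[of 2]
    by eventually_elim (rule main)
  have high: "\<forall>\<^sub>F n in sequentially. 1 - real n powr - c \<le> measure (keys (P n) (m n)) {H \<in> space (keys (P n) (m n)).
     max_probe_complexity H (m n) \<le> ennreal (60000 * ((x n)\<^sup>2 + log 2 (log 2 (real n))))}" for c
    using F eventually_loglog_ge small failure_bound_superpolynomial[of c]
  proof eventually_elim
    case (elim n)
    interpret funnel n "depth (\<delta> n)" "loglog n" "m n" "nat \<lfloor>\<delta> n * real n\<rfloor>" "real n powr (1 / 4)"
      using elim(1) by (simp add: F_def)
    have d: "0 < \<delta> n" "\<delta> n < 1" using asm n_ge by auto
    have f: "failure \<le> real n powr - c"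
      using failure_le loglog_bounds[OF elim(2)] elim by linarith
    have x: "real (depth (\<delta> n)) \<le> x n + 4" "0 \<le> x n"
      using depth_bounds[OF d] by (simp_all add: x_def)
    show ?case
      using high_probability_bound[OF f x loglog_bounds(2)[OF elim(2)] elim(2)] elim(1)
      by (simp add: P_def scheme_eq)
  qed
  show "\<exists>P. (\<forall>n\<ge>1. probe_distribution n (P n) \<and> supports_insertions (P n) (num_insertions n (\<delta> n))) \<and>
        (\<forall>\<^sub>F n in sequentially. worst_expected_probe_complexity (P n) (num_insertions n (\<delta> n))
             \<le> ennreal (60000 * (1 + (log 2 (1 / \<delta> n))\<^sup>2))) \<and>
        (\<forall>\<^sub>F n in sequentially. worst_expected_insertion_time (P n) (num_insertions n (\<delta> n))
             \<le> ennreal (60000 * (1 + (log 2 (1 / \<delta> n))\<^sup>2))) \<and>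
        (\<forall>c>0. \<forall>\<^sub>F n in sequentially.
           measure (keys (P n) (num_insertions n (\<delta> n)))
             {H \<in> space (keys (P n) (num_insertions n (\<delta> n))).
                max_probe_complexity H (num_insertions n (\<delta> n))
                  \<le> ennreal (60000 * ((log 2 (1 / \<delta> n))\<^sup>2 + log 2 (log 2 (real n))))}
             \<ge> 1 - real n powr - c) \<and>
        (\<forall>\<^sub>F n in sequentially. amortized_expected_probe_complexity (P n) (num_insertions n (\<delta> n))
             \<le> ennreal (60000 * (1 + log 2 (1 / \<delta> n))))"
    using supports main_ev high unfolding m_def x_def worst_insertion_time_eq eventually_conj_iff
    by (intro exI[of _ P]) auto
qed

end
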